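(* Let $\alpha,\beta,\kappa,\theta$ be generic, let $m,n\ge1$ and let $\lambda',\lambda$ be Young diagrams with $f=m-|\lambda'|=n-|\lambda|\ge0$. In the seminormal representation of $\mathrm{qwB}_{m,n}(\alpha,\beta,\kappa,\theta)$ on the span of the standard triples $\mathcal{T}_{m,n}(\lambda',\lambda)$ (described in the context), the Jucys–Murphy elements $J^{(n)}_2,\dots,J^{(n)}_{m+n}$ act diagonally on the basis of standard triples: for every standard triple $\tau=(B,S,W)$, $$J^{(n)}_j\,\tau=\mathrm{Wt}(\tau)_{j-1}\,\tau,\qquad j=2,\dots,m+n.$$
   Context: $\mathrm{qwB}_{m,n}(\alpha,\beta,\kappa,\theta)$ is the algebra generated by $g_1,\dots,g_{m-1}$, $h_1,\dots,h_{n-1}$, $E$ with relations: $g_j^2=(\alpha+\beta)g_j-\alpha\beta$, $h_i^2=(\alpha+\beta)h_i-\alpha\beta$; type-$A$ braid relations among the $g$'s and among the $h$'s; $g_jh_i=h_ig_j$; $E^2=\frac{\theta+1}{\kappa(\alpha+\beta)}E$; $Eg_1E=\kappa^{-1}E=Eh_1E$; $E$ commutes with $g_j$ ($j\ge2$) and $h_i$ ($i\ge2$); $Eg_1h_1^{-1}E(g_1-h_1)=0=(g_1-h_1)Eg_1h_1^{-1}E$. Jucys–Murphy elements: $J^{(n)}_1=1$, $J^{(n)}_i=(-\alpha\beta)^{-1}h_{n+1-i}J^{(n)}_{i-1}h_{n+1-i}$ for $2\le i\le n$; $J^{(n)}_{n+1}=1-(\alpha+\beta)\kappa\sum_{i=1}^{n}(-\alpha\beta)^{i-1}(h_{i-1}^{-1}h_{i-2}^{-1}\cdots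 h_1^{-1})\,E\,(h_1^{-1}h_2^{-1}\cdots h_{i-1}^{-1})$ (empty products equal $1$); $J^{(n)}_{n+j}=(-\alpha\beta)^{-1}g_{j-1}J^{(n)}_{n+j-1}g_{j-1}$ for $2\le j\le m$. Conventions: box in row $i$, column $j$ has position $(i,j)$, $\mathrm{HD}((i,j))=i-j$, $\mathrm{HD}(p_1,p_2)=\mathrm{HD}(p_1)-\mathrm{HD}(p_2)$, $q=-\beta/\alpha$. A standard triple $(B,S,W)$: $W$ standard with entries $1,\dots,n$ on a diagram $\tilde\lambda\supseteq\lambda$, $|\tilde\lambda/\lambda|=f$; $B$ a standard tableau on $\lambda'$ and $S$ an antistandard filling (strictly decreasing along rows and columns) of $\tilde\lambda/\lambda$, jointly using each of $1'<\dots<m'$ once. Weight $\mathrm{Wt}(B,S,W)=\mu\in\mathbb{C}^{m+n-1}$: $\mu_i=q^{\mathrm{HD}(\mathrm{pos}_W(i+1))}$ ($1\le i\le n-1$); $\mu_{n-1+i}=q^{\mathrm{HD}(\mathrm{pos}_B(i'))}$ if $i'\in B$, $\mu_{n-1+i}=-\theta q^{-\mathrm{HD}(\mathrm{pos}_S(i'))}$ if $i'\in S$. Seminormal action (with $F(x)=\frac{(1+x\beta/\alpha)(1+x\alpha/\beta)}{(1-x)^2}$ and functions $\eta,\zeta$ satisfying $\eta(x)\eta(1/x)=\zeta(x)\zeta(1/x)=-\alpha\beta F(x)$ and $\frac{\eta(x)\zeta(x)\eta(y)\zeta(y)}{\eta(xy)\zeta(xy)}=-\alpha\beta\frac{F(x)F(y)}{F(xy)}$):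 $h_{n-i}(B,S,W)$ is $\alpha(B,S,W)$ or $\beta(B,S,W)$ if $i,i+1$ lie in the same row or column of $W$, else $\frac{\alpha+\beta}{1-\mu_{i-1}/\mu_i}(B,S,W)+\eta(\mu_{i-1}/\mu_i)(B,S,W_{(i,i+1)})$; $g_j(B,S,W)$ is $\alpha(B,S,W)$ or $\beta(B,S,W)$ if $j',(j+1)'$ lie in the same row or column of $B$ or of $S$, else $\frac{\alpha+\beta}{1-\mu_{n+j-1}/\mu_{n+j}}(B,S,W)+\zeta(\mu_{n+j-1}/\mu_{n+j})((B,S)_{(j,j+1)},W)$; $E(B,S,W)=0$ unless $1'\in S$ and the box $b_0$ of $S$ holding $1'$ holds $n$ in $W$, in which case, with $\nu=\tilde\lambda\setminus b_0$ and $(S_b,W_b)$ obtained by moving that box to an addable box $b$ of $\nu$, $E(B,S,W)=\frac{1+\theta q^{-\mathrm{HD}(b_0)}}{\kappa(\alpha+\beta)}\sum_{b}\frac{\prod_{\delta\in\mathrm{Corners}(\nu)}(1-q^{\mathrm{HD}(\delta,b)})}{\prod_{b'\ne b}(1-q^{\mathrm{HD}(b',b)})}(B,S_b,W_b)$, sums/products over addable boxes $b,b'$ of $\nu$ and corners (removable boxes) $\delta$ of $\nu$. *)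

theory Defs
  imports Complex_Main
begin

record qwb_param =
  alp :: complex
  bet :: complex
  kap :: complex
  tht :: complex
  eta :: "complex \<Rightarrow> complex"
  zeta :: "complex \<Rightarrow> complex"

definition qpar :: "qwb_param \<Rightarrow> complex" where
  "qpar P = - bet P / alp P"

definition Ffun :: "qwb_param \<Rightarrow> complex \<Rightarrow> complex" where
  "Ffun P x = (1 + x * bet P / alp P) * (1 + x * alp P / bet P) / (1 - x)^2"

definition generic_params :: "qwb_param \<Rightarrow> bool" where
  "generic_params P \<longleftrightarrow> alp P \<noteq> 0 \<and> bet P \<noteq> 0 \<and> kap P \<noteq> 0 \<and> tht P \<noteq> 0
     \<and> alp P + bet P \<noteq> 0
     \<and> (\<forall>k::int. k \<noteq> 0 \<longrightarrow> qpar P powi k \<noteq> 1)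
     \<and> (\<forall>k::int. tht P \<noteq> qpar P powi k \<and> tht P \<noteq> - (qpar P powi k))"

text \<open>The functional equations for eta and zeta (imposed wherever both sides are defined).\<close>
definition eta_zeta_ok :: "qwb_param \<Rightarrow> bool" where
  "eta_zeta_ok P \<longleftrightarrow>
     (\<forall>x. x \<noteq> 0 \<and> x \<noteq> 1 \<longrightarrow>
        eta P x * eta P (1/x) = - alp P * bet P * Ffun P x
      \<and> zeta P x * zeta P (1/x) = - alp P * bet P * Ffun P x)
   \<and> (\<forall>x y. x \<notin> {0,1} \<and> y \<notin> {0,1} \<and> x*y \<notin> {0,1} \<and> Ffun P (x*y) \<noteq> 0
        \<and> eta P (x*y) * zeta P (x*y) \<noteq> 0 \<longrightarrow>
        eta P x * zeta P x * eta P y * zeta P y / (eta P (x*y) * zeta P (x*y))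
        = - alp P * bet P * Ffun P x * Ffun P y / Ffun P (x*y))"

type_synonym box = "nat \<times> nat"   (* (row, column), 1-indexed *)
type_synonym tab = "box \<Rightarrow> nat"   (* filling; 0 outside its shape *)
type_synonym triple = "tab \<times> tab \<times> tab"
type_synonym vec = "triple \<Rightarrow> complex"
type_synonym op = "vec \<Rightarrow> vec"

definition young :: "box set \<Rightarrow> bool" where
  "young D \<longleftrightarrow> finite D \<and> (\<forall>(i,j)\<in>D. 1 \<le> i \<and> 1 \<le> j \<and>
      (\<forall>i' j'. 1 \<le> i' \<and> i' \<le> i \<and> 1 \<le> j' \<and> j' \<le> j \<longrightarrow> (i',j') \<in> D))"

definition HD :: "box \<Rightarrow> int" where
  "HD b = int (fst b) - int (snd b)"

definition shape :: "tab \<Rightarrow> box set" where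
  "shape T = {b. T b \<noteq> 0}"

definition pos :: "tab \<Rightarrow> nat \<Rightarrow> box" where
  "pos T k = (THE b. T b = k)"

definition vals :: "tab \<Rightarrow> nat set" where
  "vals T = T ` shape T"

definition rc_incr :: "tab \<Rightarrow> box set \<Rightarrow> bool" where
  "rc_incr T D \<longleftrightarrow> (\<forall>(i,j)\<in>D. \<forall>(i',j')\<in>D.
      (i = i' \<and> j < j') \<or> (j = j' \<and> i < i') \<longrightarrow> T (i,j) < T (i',j'))"

definition rc_decr :: "tab \<Rightarrow> box set \<Rightarrow> bool" where
  "rc_decr T D \<longleftrightarrow> (\<forall>(i,j)\<in>D. \<forall>(i',j')\<in>D.
      (i = i' \<and> j < j') \<or> (j = j' \<and> i < i') \<longrightarrow> T (i,j) > T (i',j'))"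

text \<open>Standard triples (B,S,W); the labels j' are encoded as the natural numbers j;
  the diagram lambda-tilde is the shape of W.\<close>
definition std_triple :: "nat \<Rightarrow> nat \<Rightarrow> box set \<Rightarrow> box set \<Rightarrow> triple \<Rightarrow> bool" where
  "std_triple m n lam' lam \<tau> \<longleftrightarrow> (case \<tau> of (B, S, W) \<Rightarrow>
     young (shape W) \<and> lam \<subseteq> shape W \<and> card (shape W - lam) = m - card lam'
     \<and> bij_betw W (shape W) {1..n} \<and> rc_incr W (shape W)
     \<and> shape B = lam' \<and> inj_on B lam' \<and> rc_incr B lam'
     \<and> shape S = shape W - lam \<and> inj_on S (shape S) \<and> rc_decr S (shape S)
     \<and> vals B \<inter> vals S = {} \<and> vals B \<union> vals S = {1..m})"

definition Tset :: "nat \<Rightarrow> nat \<Rightarrow> box set \<Rightarrow> box set \<Rightarrow> triple set" where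
  "Tset m n lam' lam = {\<tau>. std_triple m n lam' lam \<tau>}"

text \<open>Weight. Index k = 1..m+n-1 is Wt(tau)_k of the paper; index 0 is the convention
  mu_0 = q^HD(pos_W 1) = 1 used in the formula for h_{n-1}.\<close>
definition Wt :: "qwb_param \<Rightarrow> nat \<Rightarrow> triple \<Rightarrow> nat \<Rightarrow> complex" where
  "Wt P n \<tau> k = (case \<tau> of (B, S, W) \<Rightarrow>
     if k < n then qpar P powi HD (pos W (k+1))
     else (let i = k + 1 - n in
       if i \<in> vals B then qpar P powi HD (pos B i)
       else - tht P * qpar P powi (- HD (pos S i))))"

definition delta :: "triple \<Rightarrow> vec" where
  "delta \<tau> = (\<lambda>\<sigma>. if \<sigma> = \<tau> then 1 else 0)"

definition swapv :: "nat \<Rightarrow> nat \<Rightarrow> tab \<Rightarrow> tab" where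
  "swapv a b T = (\<lambda>x. if T x = a then b else if T x = b then a else T x)"

definition addable :: "box set \<Rightarrow> box set" where
  "addable D = {b. b \<notin> D \<and> young (insert b D)}"

definition corners :: "box set \<Rightarrow> box set" where
  "corners D = {b \<in> D. young (D - {b})}"

definition h_basis :: "qwb_param \<Rightarrow> nat \<Rightarrow> nat \<Rightarrow> triple \<Rightarrow> vec" where
  "h_basis P n i \<tau> = (case \<tau> of (B, S, W) \<Rightarrow>
     let k = n - i; p = pos W k; p' = pos W (k+1) in
     if fst p = fst p' then (\<lambda>\<sigma>. alp P * delta \<tau> \<sigma>)
     else if snd p = snd p' then (\<lambda>\<sigma>. bet P * delta \<tau> \<sigma>)
     else (let x = Wt P n \<tau> (k - 1) / Wt P n \<tau> k in
       (\<lambda>\<sigma>. (alp P + bet P) / (1 - x) * delta \<tau> \<sigma>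
             + eta P x * delta (B, S, swapv k (k+1) W) \<sigma>)))"

definition g_basis :: "qwb_param \<Rightarrow> nat \<Rightarrow> nat \<Rightarrow> triple \<Rightarrow> vec" where
  "g_basis P n j \<tau> = (case \<tau> of (B, S, W) \<Rightarrow>
     let inB = (j \<in> vals B \<and> j+1 \<in> vals B);
         inS = (j \<in> vals S \<and> j+1 \<in> vals S);
         T = (if inB then B else S); p = pos T j; p' = pos T (j+1) in
     if (inB \<or> inS) \<and> fst p = fst p' then (\<lambda>\<sigma>. alp P * delta \<tau> \<sigma>)
     else if (inB \<or> inS) \<and> snd p = snd p' then (\<lambda>\<sigma>. bet P * delta \<tau> \<sigma>)
     else (let x = Wt P n \<tau> (n + j - 1) / Wt P n \<tau> (n + j) in
       (\<lambda>\<sigma>. (alp P + bet P) / (1 - x) * delta \<tau> \<sigma>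
             + zeta P x * delta (swapv j (j+1) B, swapv j (j+1) S, W) \<sigma>)))"

definition E_basis :: "qwb_param \<Rightarrow> nat \<Rightarrow> triple \<Rightarrow> vec" where
  "E_basis P n \<tau> = (case \<tau> of (B, S, W) \<Rightarrow>
     if 1 \<in> vals S \<and> W (pos S 1) = n then
       (let b0 = pos S 1; \<nu> = shape W - {b0};
            c0 = (1 + tht P * qpar P powi (- HD b0)) / (kap P * (alp P + bet P)) in
        (\<lambda>\<sigma>. \<Sum>b\<in>addable \<nu>.
            c0 * (\<Prod>d\<in>corners \<nu>. (1 - qpar P powi (HD d - HD b)))
               / (\<Prod>b'\<in>addable \<nu> - {b}. (1 - qpar P powi (HD b' - HD b)))
               * delta (B, S(b0 := 0, b := 1), W(b0 := 0, b := n)) \<sigma>))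
     else (\<lambda>\<sigma>. 0))"

definition lin :: "triple set \<Rightarrow> (triple \<Rightarrow> vec) \<Rightarrow> op" where
  "lin T X v = (\<lambda>\<sigma>. \<Sum>\<tau>\<in>T. v \<tau> * X \<tau> \<sigma>)"

definition h_op :: "qwb_param \<Rightarrow> nat \<Rightarrow> nat \<Rightarrow> box set \<Rightarrow> box set \<Rightarrow> nat \<Rightarrow> op" where
  "h_op P m n lam' lam i = lin (Tset m n lam' lam) (h_basis P n i)"

definition g_op :: "qwb_param \<Rightarrow> nat \<Rightarrow> nat \<Rightarrow> box set \<Rightarrow> box set \<Rightarrow> nat \<Rightarrow> op" where
  "g_op P m n lam' lam j = lin (Tset m n lam' lam) (g_basis P n j)"

definition E_op :: "qwb_param \<Rightarrow> nat \<Rightarrow> nat \<Rightarrow> box set \<Rightarrow> box set \<Rightarrow> op" where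
  "E_op P m n lam' lam = lin (Tset m n lam' lam) (E_basis P n)"

text \<open>h_i^{-1} = ((alpha+beta) - h_i)/(alpha beta), from the quadratic relation.\<close>
definition hinv_op :: "qwb_param \<Rightarrow> nat \<Rightarrow> nat \<Rightarrow> box set \<Rightarrow> box set \<Rightarrow> nat \<Rightarrow> op" where
  "hinv_op P m n lam' lam i = (\<lambda>v \<sigma>.
     ((alp P + bet P) * v \<sigma> - h_op P m n lam' lam i v \<sigma>) / (alp P * bet P))"

primrec Lh :: "qwb_param \<Rightarrow> nat \<Rightarrow> nat \<Rightarrow> box set \<Rightarrow> box set \<Rightarrow> nat \<Rightarrow> op" where
  "Lh P m n lam' lam 0 = id"
| "Lh P m n lam' lam (Suc k) = hinv_op P m n lam' lam (Suc k) \<circ> Lh P m n lam' lam k"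

primrec Rh :: "qwb_param \<Rightarrow> nat \<Rightarrow> nat \<Rightarrow> box set \<Rightarrow> box set \<Rightarrow> nat \<Rightarrow> op" where
  "Rh P m n lam' lam 0 = id"
| "Rh P m n lam' lam (Suc k) = Rh P m n lam' lam k \<circ> hinv_op P m n lam' lam (Suc k)"

definition J_np1 :: "qwb_param \<Rightarrow> nat \<Rightarrow> nat \<Rightarrow> box set \<Rightarrow> box set \<Rightarrow> op" where
  "J_np1 P m n lam' lam = (\<lambda>v \<sigma>. v \<sigma> - (alp P + bet P) * kap P *
     (\<Sum>i = 1..n. (- (alp P * bet P)) ^ (i - 1) *
        Lh P m n lam' lam (i - 1) (E_op P m n lam' lam (Rh P m n lam' lam (i - 1) v)) \<sigma>))"

text \<open>Action of the Jucys--Murphy element J^{(n)}_i (index i >= 1).\<close>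
primrec JM :: "qwb_param \<Rightarrow> nat \<Rightarrow> nat \<Rightarrow> box set \<Rightarrow> box set \<Rightarrow> nat \<Rightarrow> op" where
  "JM P m n lam' lam 0 = id"
| "JM P m n lam' lam (Suc k) =
     (if Suc k = 1 then id
      else if Suc k \<le> n then
        (\<lambda>v \<sigma>. h_op P m n lam' lam (n - k) (JM P m n lam' lam k (h_op P m n lam' lam (n - k) v)) \<sigma>
                / (- (alp P * bet P)))
      else if Suc k = n + 1 then J_np1 P m n lam' lam
      else
        (\<lambda>v \<sigma>. g_op P m n lam' lam (k - n) (JM P m n lam' lam k (g_op P m n lam' lam (k - n) v)) \<sigma>
                / (- (alp P * bet P))))"

end

theory Submission
  imports Defs "HOL-Computational_Algebra.Polynomial"
begin

text \<open>
  For \<open>j \<noteq> n + 1\<close> the generator conjugating the previous Jucys--Murphy element acts by a scalar or by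
  a \<open>2 \<times> 2\<close> block, and the eigenvalue follows from the functional equations of \<open>\<eta>\<close> and \<open>\<zeta>\<close>.

  For \<open>j = n + 1\<close> only the case \<open>1' \<in> S\<close> is interesting.  Let \<open>\<nu>\<close> be the shape of \<open>W\<close>
  without the box \<open>b\<^sub>0\<close> of \<open>1'\<close>.  The tableaux on the diagrams \<open>\<nu> + b\<close>, \<open>b\<close> addable, span the module of the Hecke algebra
  \<open>H\<^sub>n\<close> induced from the Specht module of \<open>\<nu>\<close>, and \<open>E\<close> is a combination of the operators
  \<open>P\<^sub>b\<^sub>b\<^sub>'\<close> that move the box of \<open>n\<close> from \<open>b\<close> to \<open>b'\<close>.  The claim reduces to: the relative trace
  \<open>\<Sum>\<^sub>i (- \<alpha> \<beta>)\<^sup>i\<^sup>-\<^sup>1 h\<^sub>i\<^sub>-\<^sub>1\<^sup>-\<^sup>1 \<cdots> h\<^sub>1\<^sup>-\<^sup>1 P\<^sub>b\<^sub>b\<^sub>' h\<^sub>1\<^sup>-\<^sup>1 \<cdots> h\<^sub>i\<^sub>-\<^sub>1\<^sup>-\<^sup>1\<close> is zero for \<open>b \<noteq> b'\<close> and, for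
  \<open>b = b'\<close>, the reciprocal of the product ratio attached to \<open>b\<close> in \<open>E\<close>.  This is shown by induction on \<open>n\<close> without using
  the braid relations: \<open>h\<^sub>1\<^sup>-\<^sup>1 P\<^sub>b\<^sub>b\<^sub>' h\<^sub>1\<^sup>-\<^sup>1\<close> is a combination of operators of the same kind one level
  below, and the scalars match by a partial fraction expansion over the corners of \<open>\<nu>\<close>.
\<close>

section \<open>Addable boxes and corners\<close>

lemma young_downward:
  assumes "young D" "(i, j) \<in> D" "1 \<le> i'" "i' \<le> i" "1 \<le> j'" "j' \<le> j"
  shows "(i', j') \<in> D"
  using assms unfolding young_def by blast

lemma young_ge_1:
  assumes "young D" "(i, j) \<in> D"
  shows "1 \<le> i" "1 \<le> j"
  using assms unfolding young_def by blast+

lemma youngI: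
  assumes "finite D" "\<And>i j. (i, j) \<in> D \<Longrightarrow> 1 \<le> i \<and> 1 \<le> j"
    and "\<And>i j i' j'. (i, j) \<in> D \<Longrightarrow> 1 \<le> i' \<Longrightarrow> i' \<le> i \<Longrightarrow> 1 \<le> j' \<Longrightarrow> j' \<le> j \<Longrightarrow> (i', j') \<in> D"
  shows "young D"
proof -
  have "1 \<le> i \<and> 1 \<le> j \<and> (\<forall>i' j'. 1 \<le> i' \<and> i' \<le> i \<and> 1 \<le> j' \<and> j' \<le> j \<longrightarrow> (i', j') \<in> D)"
    if "(i, j) \<in> D" for i j
    using assms(2)[OF that] assms(3)[OF that] by blast
  then show ?thesis unfolding young_def using assms(1) by fast
qed

lemma young_finite: "young D \<Longrightarrow> finite D"
  by (simp add: young_def)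

text \<open>Only the upper and the left neighbour can obstruct: every position weakly above and left
  of the box, other than the box itself, is dominated by one of these two.\<close>

lemma addable_iff:
  assumes "young D"
  shows "(i, j) \<in> addable D \<longleftrightarrow> (i, j) \<notin> D \<and> 1 \<le> i \<and> 1 \<le> j
    \<and> (i = 1 \<or> (i - 1, j) \<in> D) \<and> (j = 1 \<or> (i, j - 1) \<in> D)" (is "?L \<longleftrightarrow> ?R")
proof
  assume ?L
  then have n: "(i, j) \<notin> D" and y: "young (insert (i, j) D)"
    by (auto simp: addable_def)
  have ge: "1 \<le> i" "1 \<le> j" using young_ge_1[OF y] by auto
  have "(i - 1, j) \<in> D" if "i \<noteq> 1"
  proof -
    have "(i - 1, j) \<in> insert (i, j) D"
      by (rule young_downward[OF y, of i j]) (use that ge in auto)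
    then show ?thesis using ge by auto
  qed
  moreover have "(i, j - 1) \<in> D" if "j \<noteq> 1"
  proof -
    have "(i, j - 1) \<in> insert (i, j) D"
      by (rule young_downward[OF y, of i j]) (use that ge in auto)
    then show ?thesis using ge by auto
  qed
  ultimately show ?R using n ge by auto
next
  assume R: ?R
  have "(a, b) \<in> insert (i, j) D"
    if "(x, y) \<in> insert (i, j) D" "1 \<le> a" "a \<le> x" "1 \<le> b" "b \<le> y" for x y a b
  proof (cases "(x, y) \<in> D")
    case True
    then show ?thesis using young_downward[OF assms] that by blast
  next
    case False
    then have xy: "x = i" "y = j" using that by auto
    have "(a = i \<and> b = j) \<or> a < i \<or> b < j" using that xy by linarith
    then consider "a = i" "b = j" | "a < i" | "b < j" by blast
    then show ?thesis
    proof cases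
      case 2
      then have "(i - 1, j) \<in> D" using R that xy by auto
      then show ?thesis using young_downward[OF assms, of "i - 1" j a b] that xy 2 by auto
    next
      case 3
      then have "(i, j - 1) \<in> D" using R that xy by auto
      then show ?thesis using young_downward[OF assms, of i "j - 1" a b] that xy 3 by auto
    qed auto
  qed
  moreover have "1 \<le> x \<and> 1 \<le> y" if "(x, y) \<in> insert (i, j) D" for x y
    using that R young_ge_1[OF assms] by auto
  ultimately have "young (insert (i, j) D)"
    using young_finite[OF assms] by (intro youngI) (simp, blast, blast)
  then show ?L using R by (simp add: addable_def)
qed

lemma corners_iff:
  assumes "young D"
  shows "(i, j) \<in> corners D \<longleftrightarrow> (i, j) \<in> D \<and> (i + 1, j) \<notin> D \<and> (i, j + 1) \<notin> D" (is "?L \<longleftrightarrow> ?R")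
proof
  assume ?L
  then have m: "(i, j) \<in> D" and y: "young (D - {(i, j)})" by (auto simp: corners_def)
  note ge = young_ge_1[OF assms m]
  have "(i + 1, j) \<notin> D" using young_downward[OF y, of "i + 1" j i j] ge by auto
  moreover have "(i, j + 1) \<notin> D" using young_downward[OF y, of i "j + 1" i j] ge by auto
  ultimately show ?R using m by simp
next
  assume R: ?R
  have "(a, b) \<noteq> (i, j)"
    if "(x, y) \<in> D" "(x, y) \<noteq> (i, j)" "a \<le> x" "b \<le> y" for x y a b
  proof
    assume ab: "(a, b) = (i, j)"
    have "i \<le> x" "j \<le> y" "x \<noteq> i \<or> y \<noteq> j" using that ab by auto
    then have "(i + 1 \<le> x \<and> j \<le> y) \<or> (i \<le> x \<and> j + 1 \<le> y)" by linarith
    then show False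
      using young_downward[OF assms that(1), of "i + 1" j] young_downward[OF assms that(1), of i "j + 1"]
        R young_ge_1[OF assms, of i j] by auto
  qed
  moreover have "1 \<le> x \<and> 1 \<le> y" if "(x, y) \<in> D" for x y
    using that young_ge_1[OF assms] by auto
  moreover have "(a, b) \<in> D" if "(x, y) \<in> D" "1 \<le> a" "a \<le> x" "1 \<le> b" "b \<le> y" for x y a b
    using young_downward[OF assms] that by blast
  ultimately have "young (D - {(i, j)})"
    using young_finite[OF assms] by (intro youngI) (simp, blast, blast)
  then show ?L using R by (simp add: corners_def)
qed

lemma young_insert_addable: "b \<in> addable D \<Longrightarrow> young (insert b D)"
  by (simp add: addable_def)

lemma addable_notin: "b \<in> addable D \<Longrightarrow> b \<notin> D"
  by (simp add: addable_def)

lemma young_remove_corner: "b \<in> corners D \<Longrightarrow> young (D - {b})"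
  by (simp add: corners_def)

lemma corner_in: "b \<in> corners D \<Longrightarrow> b \<in> D"
  by (simp add: corners_def)

lemma addable_remove_corner: "young D \<Longrightarrow> b \<in> corners D \<Longrightarrow> b \<in> addable (D - {b})"
  by (auto simp: corners_def addable_def insert_absorb)

lemma corner_insert_addable: "young D \<Longrightarrow> b \<in> addable D \<Longrightarrow> b \<in> corners (insert b D)"
  by (auto simp: corners_def addable_def)

lemma finite_addable:
  assumes "young D"
  shows "finite (addable D)"
proof (rule finite_subset)
  show "addable D \<subseteq> {(1, 1)} \<union> (\<lambda>(i, j). (i + 1, j)) ` D \<union> (\<lambda>(i, j). (i, j + 1)) ` D"
  proof
    fix b assume b: "b \<in> addable D"
    obtain i j where ij: "b = (i, j)" by force
    have R: "1 \<le> i" "1 \<le> j" "i = 1 \<or> (i - 1, j) \<in> D" "j = 1 \<or> (i, j - 1) \<in> D"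
      using b addable_iff[OF assms] ij by auto
    have "b \<in> (\<lambda>(i, j). (i + 1, j)) ` D" if "i \<noteq> 1"
      using R that ij by (intro image_eqI[of _ _ "(i - 1, j)"]) auto
    moreover have "b \<in> (\<lambda>(i, j). (i, j + 1)) ` D" if "j \<noteq> 1"
      using R that ij by (intro image_eqI[of _ _ "(i, j - 1)"]) auto
    ultimately show "b \<in> {(1, 1)} \<union> (\<lambda>(i, j). (i + 1, j)) ` D \<union> (\<lambda>(i, j). (i, j + 1)) ` D"
      using ij by auto
  qed
qed (use young_finite[OF assms] in auto)

lemma finite_corners: "young D \<Longrightarrow> finite (corners D)"
  by (simp add: corners_def young_finite)

text \<open>Equal values of \<open>HD\<close> put both boxes on one diagonal. Writing the offset as
  \<open>Suc e\<close> isolates the two strict cases, which closure properties of the diagram refute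
  later.\<close>

lemma HD_eq_cases:
  assumes "HD (i, j) = HD (k, l)"
  obtains "k = i" "l = j" | e where "k = i + Suc e" "l = j + Suc e"
    | e where "i = k + Suc e" "j = l + Suc e"
proof -
  have e: "int i + int l = int k + int j" using assms by (simp add: HD_def)
  consider "k = i" | "k > i" | "i > k" by linarith
  then show thesis
  proof cases
    case 1
    then show ?thesis using e that(1) by simp
  next
    case 2
    then show ?thesis using e that(2)[of "k - i - 1"] by simp
  next
    case 3
    then show ?thesis using e that(3)[of "i - k - 1"] by simp
  qed
qed

text \<open>Of two addable boxes on one diagonal, the neighbour above the lower one already lies in
  \<open>D\<close> and dominates the upper one, which would then lie in \<open>D\<close> too. This
  keeps the denominators in the formula for \<open>E\<close> nonzero.\<close>

lemma inj_on_HD_addable: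
  assumes "young D"
  shows "inj_on HD (addable D)"
proof (rule inj_onI)
  have key: False if "(i, j) \<in> addable D" "(i + Suc e, j + Suc e) \<in> addable D" for i j e
  proof -
    have "(i + e, j + Suc e) \<in> D" "1 \<le> i" "1 \<le> j" "(i, j) \<notin> D"
      using that addable_iff[OF assms] by auto
    then show False using young_downward[OF assms, of "i + e" "j + Suc e" i j] by simp
  qed
  fix b c assume "b \<in> addable D" "c \<in> addable D" "HD b = HD c"
  then show "b = c"
    by (cases b; cases c) (auto elim!: HD_eq_cases dest: key)
qed

lemma inj_on_HD_corners:
  assumes "young D"
  shows "inj_on HD (corners D)"
proof (rule inj_onI)
  have key: False if "(i, j) \<in> corners D" "(i + Suc e, j + Suc e) \<in> corners D" for i j e
  proof -
    have "(i + Suc e, j + Suc e) \<in> D" "(i, j) \<in> D" "(i + 1, j) \<notin> D"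
      using that corners_iff[OF assms] by auto
    then show False
      using young_downward[OF assms, of "i + Suc e" "j + Suc e" "i + 1" j] young_ge_1[OF assms, of i j]
      by simp
  qed
  fix b c assume "b \<in> corners D" "c \<in> corners D" "HD b = HD c"
  then show "b = c"
    by (cases b; cases c) (auto elim!: HD_eq_cases dest: key)
qed

text \<open>If a corner shared the diagonal of an addable box, downward closure would put either the
  box to the right of the corner or the addable box itself into \<open>D\<close>. This keeps the
  factors attached to corners nonzero.\<close>

lemma HD_corner_neq_addable:
  assumes "young D" "b \<in> addable D" "d \<in> corners D"
  shows "HD d \<noteq> HD b"
proof
  assume eq: "HD d = HD b"
  obtain i j where b: "b = (i, j)" by force
  obtain k l where d: "d = (k, l)" by force
  have R: "(i, j) \<notin> D" "1 \<le> i" "1 \<le> j" "i = 1 \<or> (i - 1, j) \<in> D"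
    using assms addable_iff b by auto
  have C: "(k, l) \<in> D" "(k, l + 1) \<notin> D"
    using assms corners_iff d by auto
  note ge = young_ge_1[OF assms(1) C(1)]
  from eq have "HD (k, l) = HD (i, j)" by (simp add: b d)
  then show False
  proof (cases rule: HD_eq_cases)
    case 1
    then show ?thesis using R C by simp
  next
    case (2 e)
    then have "(i - 1, j) \<in> D" using R ge by auto
    then show ?thesis using young_downward[OF assms(1), of "i - 1" j k "l + 1"] 2 ge C by simp
  next
    case (3 e)
    then show ?thesis using young_downward[OF assms(1) C(1), of i j] R by simp
  qed
qed

lemma addable_same_row_corner:
  assumes "young D" "b \<in> addable D" "d \<in> corners D" "fst b = fst d"
  shows "snd b = snd d + 1"
proof -
  obtain i j where b: "b = (i, j)" by force
  obtain l where d: "d = (i, l)" using assms(4) b by (metis fst_conv surj_pair)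
  have R: "(i, j) \<notin> D" "1 \<le> i" "1 \<le> j" "j = 1 \<or> (i, j - 1) \<in> D"
    using assms addable_iff b by auto
  have C: "(i, l) \<in> D" "(i, l + 1) \<notin> D"
    using assms corners_iff d by auto
  have "l < j" using young_downward[OF assms(1) C(1), of i j] R by force
  moreover have "j \<le> l + 1"
    using young_downward[OF assms(1), of i "j - 1" i "l + 1"] R C calculation young_ge_1[OF assms(1) C(1)] by force
  ultimately show ?thesis by (simp add: b d)
qed

lemma addable_same_col_corner:
  assumes "young D" "b \<in> addable D" "d \<in> corners D" "snd b = snd d"
  shows "fst b = fst d + 1"
proof -
  obtain i j where b: "b = (i, j)" by force
  obtain k where d: "d = (k, j)" using assms(4) b by (metis snd_conv surj_pair)
  have R: "(i, j) \<notin> D" "1 \<le> i" "1 \<le> j" "i = 1 \<or> (i - 1, j) \<in> D"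
    using assms addable_iff b by auto
  have C: "(k, j) \<in> D" "(k + 1, j) \<notin> D"
    using assms corners_iff d by auto
  have "k < i" using young_downward[OF assms(1) C(1), of i j] R by force
  moreover have "i \<le> k + 1"
    using young_downward[OF assms(1), of "i - 1" j "k + 1" j] R C calculation young_ge_1[OF assms(1) C(1)] by force
  ultimately show ?thesis by (simp add: b d)
qed

lemma addable_after_removing_corner:
  assumes "young D" "b \<in> addable D" "d \<in> corners D" "fst b \<noteq> fst d" "snd b \<noteq> snd d"
  shows "b \<in> addable (D - {d})"
  using assms(2,4,5) addable_iff[OF assms(1)] addable_iff[OF young_remove_corner[OF assms(3)]]
  by (cases b) auto

text \<open>The positions directly below and directly right of \<open>d\<close> lie outside
  \<open>D\<close>; any other addable box on their diagonals would force one of them into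
  \<open>D\<close> or lie in \<open>D\<close> itself. Non-aligned pairs therefore stay away from the
  zeros of \<open>Ffun\<close>.\<close>

lemma HD_adjacent_corner:
  assumes "young D" "b \<in> addable D" "d \<in> corners D"
  shows "HD b = HD d + 1 \<Longrightarrow> snd b = snd d" "HD b = HD d - 1 \<Longrightarrow> fst b = fst d"
proof -
  obtain i j where b: "b = (i, j)" by force
  obtain k l where d: "d = (k, l)" by force
  have R: "(i, j) \<notin> D" "1 \<le> i" "1 \<le> j" "i = 1 \<or> (i - 1, j) \<in> D" "j = 1 \<or> (i, j - 1) \<in> D"
    using assms addable_iff b by auto
  have C: "(k, l) \<in> D" "(k + 1, l) \<notin> D" "(k, l + 1) \<notin> D"
    using assms corners_iff d by auto
  note ge = young_ge_1[OF assms(1) C(1)]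
  { assume "HD b = HD d + 1"
    then have "HD (k + 1, l) = HD (i, j)" by (simp add: b d HD_def)
    then show "snd b = snd d"
    proof (cases rule: HD_eq_cases)
      case (2 e)
      then have "(i - 1, j) \<in> D" using R ge by auto
      then show ?thesis using young_downward[OF assms(1), of "i - 1" j "k + 1" l] 2 ge C by simp
    next
      case (3 e)
      then show ?thesis using young_downward[OF assms(1) C(1), of i j] R by simp
    qed (simp add: b d) }
  { assume "HD b = HD d - 1"
    then have "HD (k, l + 1) = HD (i, j)" by (simp add: b d HD_def)
    then show "fst b = fst d"
    proof (cases rule: HD_eq_cases)
      case (2 e)
      then have "(i, j - 1) \<in> D" using R ge by auto
      then show ?thesis using young_downward[OF assms(1), of i "j - 1" k "l + 1"] 2 ge C by simp
    next
      case (3 e)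
      then show ?thesis using young_downward[OF assms(1) C(1), of i j] R by simp
    qed (simp add: b d) }
qed

lemma two_corners_not_aligned:
  assumes "young D" "b \<in> corners D" "c \<in> corners D" "b \<noteq> c"
  shows "fst b \<noteq> fst c" "snd b \<noteq> snd c"
proof -
  obtain i j where b: "b = (i, j)" by force
  obtain k l where c: "c = (k, l)" by force
  have B: "(i, j) \<in> D" "(i + 1, j) \<notin> D" "(i, j + 1) \<notin> D"
    using assms corners_iff b by auto
  have C: "(k, l) \<in> D" "(k + 1, l) \<notin> D" "(k, l + 1) \<notin> D"
    using assms corners_iff c by auto
  note ge = young_ge_1[OF assms(1) C(1)] young_ge_1[OF assms(1) B(1)]
  show "fst b \<noteq> fst c"
    using young_downward[OF assms(1) B(1), of i "l + 1"] young_downward[OF assms(1) C(1), of k "j + 1"]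
      assms(4) ge B C by (force simp: b c not_less_eq_eq linorder_neq_iff)
  show "snd b \<noteq> snd c"
    using young_downward[OF assms(1) B(1), of "k + 1" j] young_downward[OF assms(1) C(1), of "i + 1" l]
      assms(4) ge B C by (force simp: b c not_less_eq_eq linorder_neq_iff)
qed

text \<open>
  Adding the box \<^term>\<open>(r, c)\<close> either creates the addable box below it or destroys the
  corner to its left; both have the same content.  The same holds for the box to its right and
  the corner above it.
\<close>
lemma prod_addable_corners_insert:
  fixes f :: "int \<Rightarrow> 'a::comm_monoid_mult"
  assumes "young D" "b \<in> addable D"
  shows "(\<Prod>x\<in>addable (insert b D). f (HD x)) * (\<Prod>x\<in>corners D. f (HD x)) =
    (\<Prod>x\<in>addable D - {b}. f (HD x)) * (\<Prod>x\<in>corners (insert b D) - {b}. f (HD x))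
      * (f (HD b + 1) * f (HD b - 1))"
proof -
  obtain r c where b: "b = (r, c)" by force
  have yD': "young (insert b D)" by (rule young_insert_addable[OF assms(2)])
  have R: "(r, c) \<notin> D" "1 \<le> r" "1 \<le> c" "r = 1 \<or> (r - 1, c) \<in> D" "c = 1 \<or> (r, c - 1) \<in> D"
    using assms addable_iff b by auto
  have out: "(x, y) \<notin> D" if "r \<le> x" "c \<le> y" for x y
    using young_downward[OF assms(1), of x y r c] R that by auto
  \<comment> \<open>\<open>d1\<close> decides between the box below and the corner to the left,
    \<open>d2\<close> between the box to the right and the corner above.\<close>
  define d1 where "d1 \<longleftrightarrow> c = 1 \<or> (r + 1, c - 1) \<in> D"
  define d2 where "d2 \<longleftrightarrow> r = 1 \<or> (r - 1, c + 1) \<in> D"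
  have notA: "(r + 1, c) \<notin> addable D - {b}" "(r, c + 1) \<notin> addable D - {b}"
    using addable_iff[OF assms(1)] R by auto
  have a1: "(r + 1, c) \<in> addable (insert b D) \<longleftrightarrow> d1"
    using addable_iff[OF yD', of "r + 1" c] out[of "r + 1" c] R by (auto simp: b d1_def)
  have a2: "(r, c + 1) \<in> addable (insert b D) \<longleftrightarrow> d2"
    using addable_iff[OF yD', of r "c + 1"] out[of r "c + 1"] R by (auto simp: b d2_def)
  have A: "addable (insert b D) = (addable D - {b}) \<union> ((if d1 then {(r + 1, c)} else {}) \<union> (if d2 then {(r, c + 1)} else {}))"
  proof (intro set_eqI)
    fix x :: box
    obtain i j where x: "x = (i, j)" by force
    show "x \<in> addable (insert b D) \<longleftrightarrow> x \<in> (addable D - {b}) \<union> ((if d1 then {(r + 1, c)} else {}) \<union> (if d2 then {(r, c + 1)} else {}))"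
    proof (cases "x = (r + 1, c) \<or> x = (r, c + 1)")
      case True
      then show ?thesis using a1 a2 notA by auto
    next
      case False
      have "i - 1 \<noteq> r \<or> j \<noteq> c" "i \<noteq> r \<or> j - 1 \<noteq> c" using False R by (auto simp: x)
      then have "x \<in> addable (insert b D) \<longleftrightarrow> x \<in> addable D - {b}"
        unfolding x addable_iff[OF yD'] Diff_iff addable_iff[OF assms(1)] by (auto simp: b)
      then show ?thesis using False by auto
    qed
  qed
  have C: "corners D = (corners (insert b D) - {b}) \<union> ((if d1 then {} else {(r, c - 1)}) \<union> (if d2 then {} else {(r - 1, c)}))"
  proof (intro set_eqI)
    fix x :: box
    obtain i j where x: "x = (i, j)" by force
    show "x \<in> corners D \<longleftrightarrow> x \<in> (corners (insert b D) - {b}) \<union> ((if d1 then {} else {(r, c - 1)}) \<union> (if d2 then {} else {(r - 1, c)}))"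
    proof (cases "(i = r \<and> j + 1 = c) \<or> (i + 1 = r \<and> j = c)")
      case True
      then show ?thesis
      proof
        assume e: "i = r \<and> j + 1 = c"
        have n1: "x \<notin> corners (insert b D) - {b}" using corners_iff[OF yD', of i j] e by (auto simp: x b)
        have "x \<in> corners D \<longleftrightarrow> (i, j) \<in> D \<and> (i + 1, j) \<notin> D"
          using corners_iff[OF assms(1), of i j] e R by (auto simp: x)
        also have "\<dots> \<longleftrightarrow> \<not> d1" using e R young_ge_1[OF assms(1), of i j] by (auto simp: d1_def)
        finally show ?thesis using n1 e R by (auto simp: x)
      next
        assume e: "i + 1 = r \<and> j = c"
        have n1: "x \<notin> corners (insert b D) - {b}" using corners_iff[OF yD', of i j] e by (auto simp: x b)
        have "x \<in> corners D \<longleftrightarrow> (i, j) \<in> D \<and> (i, j + 1) \<notin> D"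
          using corners_iff[OF assms(1), of i j] e R by (auto simp: x)
        also have "\<dots> \<longleftrightarrow> \<not> d2" using e R young_ge_1[OF assms(1), of i j] by (auto simp: d2_def)
        finally show ?thesis using n1 e R by (auto simp: x)
      qed
    next
      case False
      have "i + 1 \<noteq> r \<or> j \<noteq> c" "i \<noteq> r \<or> j + 1 \<noteq> c" using False by auto
      then have "x \<in> corners D \<longleftrightarrow> x \<in> corners (insert b D) - {b}"
        unfolding x corners_iff[OF yD'] Diff_iff corners_iff[OF assms(1)] using R by (auto simp: b)
      moreover have "x \<noteq> (r, c - 1)" if "\<not> d1" using False R that by (auto simp: x d1_def)
      moreover have "x \<noteq> (r - 1, c)" if "\<not> d2" using False R that by (auto simp: x d2_def)
      ultimately show ?thesis by auto
    qed
  qed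
  have fin: "finite (addable D - {b})" "finite (corners (insert b D) - {b})"
    using finite_addable[OF assms(1)] finite_corners[OF yD'] by auto
  have notC: "(r, c - 1) \<notin> corners (insert b D) - {b}" if "\<not> d1"
    using corners_iff[OF yD'] that R by (auto simp: d1_def b)
  have notC2: "(r - 1, c) \<notin> corners (insert b D) - {b}" if "\<not> d2"
    using corners_iff[OF yD'] that R by (auto simp: d2_def b)
  have "(\<Prod>x\<in>addable (insert b D). f (HD x)) = (\<Prod>x\<in>addable D - {b}. f (HD x)) *
      ((if d1 then f (HD b + 1) else 1) * (if d2 then f (HD b - 1) else 1))"
    unfolding A using notA fin by (subst prod.union_disjoint) (auto simp: b HD_def algebra_simps)
  moreover have "(\<Prod>x\<in>corners D. f (HD x)) = (\<Prod>x\<in>corners (insert b D) - {b}. f (HD x)) *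
      ((if d1 then 1 else f (HD b + 1)) * (if d2 then 1 else f (HD b - 1)))"
  proof -
    have dis: "(corners (insert b D) - {b}) \<inter> ((if d1 then {} else {(r, c - 1)}) \<union> (if d2 then {} else {(r - 1, c)})) = {}"
      using notC notC2 by auto
    have h1: "HD (r, c - 1) = HD b + 1" if "\<not> d1" using R by (simp add: b HD_def of_nat_diff)
    have h2: "HD (r - 1, c) = HD b - 1" if "\<not> d2" using R by (simp add: b HD_def of_nat_diff)
    have "(\<Prod>x\<in>(if d1 then {} else {(r, c - 1)}) \<union> (if d2 then {} else {(r - 1, c)}). f (HD x)) =
      (if d1 then 1 else f (HD b + 1)) * (if d2 then 1 else f (HD b - 1))"
      using h1 h2 R by (subst prod.union_disjoint) auto
    then show ?thesis by (subst C, subst prod.union_disjoint) (use fin dis in auto)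
  qed
  ultimately show ?thesis by (simp add: mult_ac)
qed

lemma addable_empty: "addable {} = {(1, 1)}"
  using addable_iff[of "{}"] by (auto simp: young_def)

lemma corners_empty: "corners {} = {}"
  by (simp add: corners_def)

section \<open>Partial fractions by polynomial interpolation\<close>

lemma degree_prod_linear_le:
  fixes g :: "'a \<Rightarrow> 'b::idom"
  shows "degree (\<Prod>a\<in>X. [:1, - g a:]) \<le> card X"
proof (cases "finite X")
  case True
  then show ?thesis
  proof (induction X)
    case (insert x X)
    have "degree (\<Prod>a\<in>insert x X. [:1, - g a:]) \<le> degree [:1, - g x:] + degree (\<Prod>a\<in>X. [:1, - g a:])"
      by (simp only: prod.insert[OF insert.hyps] degree_mult_le)
    also have "\<dots> \<le> 1 + card X" using insert.IH by (intro add_mono) auto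
    finally show ?case using insert.hyps by simp
  qed simp
qed simp

text \<open>With denominators cleared, both sides are polynomials in \<open>z\<close> of degree at
  most \<open>card C\<close>, so agreement at \<open>card C + 1\<close> points suffices. The terms
  \<open>v c * z / (1 - v c * z)\<close> vanish at 0, where both sides equal 1.\<close>

lemma partial_fractions:
  fixes u :: "'a \<Rightarrow> 'c::field_char_0" and v :: "'b \<Rightarrow> 'c"
  assumes "finite A" "finite C" "card A = card C" "inj_on v C"
    and nz: "\<And>c. c \<in> C \<Longrightarrow> v c \<noteq> 0" and z: "\<And>c. c \<in> C \<Longrightarrow> v c * z \<noteq> 1"
  shows "(\<Prod>a\<in>A. 1 - u a * z) / (\<Prod>c\<in>C. 1 - v c * z) =
    1 + (\<Sum>c\<in>C. (\<Prod>a\<in>A. 1 - u a / v c) / (\<Prod>d\<in>C - {c}. 1 - v d / v c) * (v c * z / (1 - v c * z)))"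
proof -
  define r where "r c = (\<Prod>a\<in>A. 1 - u a / v c) / (\<Prod>d\<in>C - {c}. 1 - v d / v c)" for c
  define p where "p = (\<Prod>a\<in>A. [:1, - u a:])"
  define s where "s c = smult (r c) ([:0, v c:] * (\<Prod>d\<in>C - {c}. [:1, - v d:]))" for c
  define w where "w = (\<Prod>c\<in>C. [:1, - v c:]) + (\<Sum>c\<in>C. s c)"
  have degp: "degree p \<le> card C" unfolding p_def using degree_prod_linear_le[of u A] assms(3) by simp
  have degs: "degree (s c) \<le> card C" if "c \<in> C" for c
  proof -
    have "degree (s c) \<le> degree [:0, v c:] + degree (\<Prod>d\<in>C - {c}. [:1, - v d:])"
      unfolding s_def by (rule order.trans[OF degree_smult_le degree_mult_le])
    also have "\<dots> \<le> 1 + card (C - {c})" using degree_prod_linear_le[of v "C - {c}"] by (intro add_mono) auto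
    also have "\<dots> = card C" using that assms(2) by (metis card_Suc_Diff1 plus_1_eq_Suc)
    finally show ?thesis .
  qed
  have degw: "degree w \<le> card C"
    unfolding w_def using degree_prod_linear_le[of v C] degs by (intro degree_add_le degree_sum_le assms(2)) auto
  \<comment> \<open>The interpolation points: 0 and the poles, which are distinct because
    \<open>v\<close> is injective and nonzero on \<open>C\<close>.\<close>
  define X where "X = insert 0 ((\<lambda>c. 1 / v c) ` C)"
  have "inj_on (\<lambda>c. 1 / v c) C" using assms(4) by (auto simp: inj_on_def)
  then have "card X = Suc (card C)"
    unfolding X_def using assms(2) nz by (subst card_insert_disjoint) (auto simp: card_image)
  moreover have "poly p x = poly w x" if "x \<in> X" for x
  proof (cases "x = 0")
    case True
    then show ?thesis by (simp add: p_def w_def s_def poly_prod poly_sum)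
  next
    case False
    then obtain c where c: "c \<in> C" "x = 1 / v c" using \<open>x \<in> X\<close> by (auto simp: X_def)
    have nz1: "(\<Prod>d\<in>C - {c}. 1 - v d / v c) \<noteq> 0"
      using assms(2,4) c nz by (auto simp: inj_on_def)
    have z0: "(\<Prod>d\<in>C. 1 - v d / v c) = 0" using c assms(2) nz by auto
    \<comment> \<open>At the pole of \<open>c\<close> every other summand contains the vanishing
      factor of \<open>c\<close>, and \<open>r c\<close> is chosen so that the summand of
      \<open>c\<close> takes the value of \<open>p\<close> there.\<close>
    have "poly (s d) x = (if d = c then poly p x else 0)" if "d \<in> C" for d
    proof (cases "d = c")
      case True
      then show ?thesis using nz1 c nz by (simp add: s_def p_def poly_prod r_def)
    next
      case False
      then have "(\<Prod>d'\<in>C - {d}. 1 - v d' / v c) = 0" using c assms(2) nz by auto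
      then show ?thesis using False c by (simp add: s_def poly_prod)
    qed
    then have "(\<Sum>d\<in>C. poly (s d) x) = poly p x" using c assms(2) by simp
    then show ?thesis using z0 c by (simp add: w_def poly_sum poly_prod)
  qed
  ultimately have "p = w" using degp degw by (intro poly_eqI_degree[of X]) auto
  then have "poly p z = poly w z" by simp
  then have eq: "(\<Prod>a\<in>A. 1 - u a * z) = (\<Prod>c\<in>C. 1 - v c * z) +
      (\<Sum>c\<in>C. r c * (v c * z * (\<Prod>d\<in>C - {c}. 1 - v d * z)))"
    by (simp add: p_def w_def s_def poly_sum poly_prod mult_ac)
  have nzC: "(\<Prod>c\<in>C. 1 - v c * z) \<noteq> 0" using z assms(2) by auto
  have "(\<Prod>a\<in>A. 1 - u a * z) / (\<Prod>c\<in>C. 1 - v c * z) =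
      1 + (\<Sum>c\<in>C. r c * (v c * z * (\<Prod>d\<in>C - {c}. 1 - v d * z)) / (\<Prod>c\<in>C. 1 - v c * z))"
    unfolding eq using nzC by (simp add: add_divide_distrib sum_divide_distrib)
  also have "(\<Sum>c\<in>C. r c * (v c * z * (\<Prod>d\<in>C - {c}. 1 - v d * z)) / (\<Prod>c\<in>C. 1 - v c * z)) =
      (\<Sum>c\<in>C. r c * (v c * z / (1 - v c * z)))"
  proof (rule sum.cong[OF refl])
    fix c assume c: "c \<in> C"
    have "(\<Prod>c\<in>C. 1 - v c * z) = (1 - v c * z) * (\<Prod>d\<in>C - {c}. 1 - v d * z)"
      using c assms(2) by (rule prod.remove[rotated])
    then show "r c * (v c * z * (\<Prod>d\<in>C - {c}. 1 - v d * z)) / (\<Prod>c\<in>C. 1 - v c * z) =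
        r c * (v c * z / (1 - v c * z))"
      using nzC by auto
  qed
  finally show ?thesis by (simp add: r_def)
qed

section \<open>Standard paths and the relative trace\<close>

text \<open>A standard tableau is recorded as the order in which its boxes are added, most recent
  first. Deleting the largest entry is then taking the tail, and the generator with index 1 concerns
  the first two list elements.\<close>

primrec std_path :: "box list \<Rightarrow> bool" where
  "std_path [] \<longleftrightarrow> True"
| "std_path (b # L) \<longleftrightarrow> b \<in> addable (set L) \<and> std_path L"

lemma std_path_young: "std_path L \<Longrightarrow> young (set L)"
  by (cases L) (simp_all add: young_insert_addable young_def[of "{}"])

lemma std_path_distinct: "std_path L \<Longrightarrow> distinct L"
  by (induction L) (auto dest: addable_notin)

lemma std_path_hd_corner:
  assumes "std_path (b # L)"
  shows "b \<in> corners (set (b # L))"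
  using assms corner_insert_addable[of "set L" b] std_path_young[of L] by simp

text \<open>Addability depends on the upper and left neighbours only, and boxes that share neither
  row nor column are not neighbours, so neither box waits for the other.\<close>

lemma std_path_swap:
  assumes "std_path (c # d # U)" "fst c \<noteq> fst d" "snd c \<noteq> snd d"
  shows "std_path (d # c # U)"
proof -
  have U: "std_path U" "d \<in> addable (set U)" "c \<in> addable (insert d (set U))" using assms by auto
  have y: "young (set U)" using std_path_young[OF U(1)] .
  have cU: "c \<in> addable (set U)"
    using addable_iff[OF young_insert_addable[OF U(2)]] addable_iff[OF y] U(3) assms(2,3)
    by (cases c) auto
  have "d \<in> addable (insert c (set U))"
    using addable_iff[OF young_insert_addable[OF cU]] addable_iff[OF y] U(2,3) addable_notin[OF U(3)]
    by (cases d) auto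
  then show ?thesis using cU U(1) by simp
qed

lemma card_addable:
  assumes "std_path L"
  shows "card (addable (set L)) = card (corners (set L)) + 1"
  using assms
proof (induction L)
  case Nil
  then show ?case by (simp add: addable_empty corners_empty)
next
  case (Cons b L)
  let ?D = "set L"
  have b: "b \<in> addable ?D" and y: "young ?D" using Cons.prems std_path_young by auto
  have y': "young (insert b ?D)" using young_insert_addable[OF b] .
  have c: "b \<in> corners (insert b ?D)" using corner_insert_addable[OF y b] .
  have "card (addable ?D) \<ge> 1" "card (corners (insert b ?D)) \<ge> 1"
    using b c finite_addable[OF y] finite_corners[OF y'] by (auto simp: Suc_le_eq card_gt_0_iff)
  \<comment> \<open>For the constant function 2 the product identity becomes an identity of powers
    of 2, whose exponents count addable boxes and corners.\<close>
  moreover have "(2::nat) ^ (card (addable (insert b ?D)) + card (corners ?D)) =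
      2 ^ (card (addable ?D - {b}) + card (corners (insert b ?D) - {b}) + 2)"
    using prod_addable_corners_insert[OF y b, of "\<lambda>_. 2::nat"] by (simp add: power_add)
  then have "card (addable (insert b ?D)) + card (corners ?D) =
      card (addable ?D - {b}) + card (corners (insert b ?D) - {b}) + 2"
    by (subst (asm) power_inject_exp) auto
  ultimately show ?case using Cons b c finite_addable[OF y] finite_corners[OF y'] by simp
qed

section \<open>Generic parameters, the coefficients of \<open>E\<close> and the entries of the
  inverse generators\<close>

locale qwb =
  fixes P :: qwb_param
  assumes generic: "generic_params P" and ez: "eta_zeta_ok P"
begin

abbreviation "q \<equiv> qpar P"
abbreviation "\<alpha> \<equiv> alp P"
abbreviation "\<beta> \<equiv> bet P"

lemma nz [simp]: "\<alpha> \<noteq> 0" "\<beta> \<noteq> 0" "kap P \<noteq> 0" "tht P \<noteq> 0" "\<alpha> + \<beta> \<noteq> 0"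
  using generic by (auto simp: generic_params_def)

lemma q_nz [simp]: "q \<noteq> 0"
  by (simp add: qpar_def)

lemma beta_eq: "\<beta> = - q * \<alpha>"
  by (simp add: qpar_def)

lemma q_powi_eq_1_iff [simp]: "q powi k = 1 \<longleftrightarrow> k = 0"
  using generic by (auto simp: generic_params_def)

lemma q_neq_1 [simp]: "q \<noteq> 1"
  using q_powi_eq_1_iff[of 1] by simp

lemma q_powi_inject [simp]: "q powi k = q powi l \<longleftrightarrow> k = l"
  using q_powi_eq_1_iff[of "k - l"] by (auto simp: power_int_diff)

lemma Ffun_eq: "Ffun P x = (1 - q * x) * (1 - x / q) / (1 - x)\<^sup>2"
  by (simp add: Ffun_def qpar_def field_simps)

text \<open>The reciprocal of the coefficient of \<open>(B, S\<^sub>b, W\<^sub>b)\<close> in \<open>E (B, S, W)\<close>, without the factor that does not depend on \<open>b\<close>.\<close>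
definition ecoef :: "box \<Rightarrow> box set \<Rightarrow> complex" where
  "ecoef b D = (\<Prod>a\<in>addable D - {b}. 1 - q powi (HD a - HD b)) / (\<Prod>d\<in>corners D. 1 - q powi (HD d - HD b))"

lemma prod_addable_nz:
  assumes "young D" "b \<in> addable D"
  shows "(\<Prod>a\<in>addable D - {b}. 1 - q powi (HD a - HD b)) \<noteq> 0"
  using assms finite_addable inj_on_HD_addable[OF assms(1)] by (auto simp: inj_on_def)

lemma prod_corners_nz:
  assumes "young D" "b \<in> addable D"
  shows "(\<Prod>d\<in>corners D. 1 - q powi (HD d - HD b)) \<noteq> 0"
  using assms finite_corners HD_corner_neq_addable[OF assms] by auto

text \<open>By \<open>prod_addable_corners_insert\<close>, adding \<open>c\<close> back to
  \<open>D - {c}\<close> changes the products only at the contents \<open>HD c\<close>,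
  \<open>HD c + 1\<close> and \<open>HD c - 1\<close>. The factors there are
  \<open>(1 - x)\<^sup>2\<close> below and \<open>(1 - q * x) * (1 - x / q)\<close> above, which is
  \<open>Ffun\<close> in the form \<open>Ffun_eq\<close>.\<close>

lemma ecoef_remove_corner:
  assumes y: "young D" and b: "b \<in> addable D" and c: "c \<in> corners D"
    and ne: "fst b \<noteq> fst c" "snd b \<noteq> snd c"
  shows "ecoef b D = Ffun P (q powi (HD c - HD b)) * ecoef b (D - {c})"
proof -
  \<comment> \<open>The value 1 at the content of \<open>b\<close> lets the product run over all
    addable boxes without changing it. Since \<open>b\<close> and \<open>c\<close> are not aligned,
    this exceptional value is not met at \<open>HD c + 1\<close> or \<open>HD c - 1\<close>.\<close>
  define f where "f k = (if k = HD b then 1 else 1 - q powi (k - HD b))" for k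
  define x where "x = q powi (HD c - HD b)"
  have y1: "young (D - {c})" using young_remove_corner[OF c] .
  have b1: "b \<in> addable (D - {c})" using addable_after_removing_corner[OF assms] .
  have c1: "c \<in> addable (D - {c})" using addable_remove_corner[OF y c] .
  have ins: "insert c (D - {c}) = D" using corner_in[OF c] by auto
  have cb: "HD c \<noteq> HD b" using HD_corner_neq_addable[OF y b c] .
  have x: "x \<noteq> 1" using cb by (simp add: x_def)
  have f1: "f (HD c + 1) = 1 - q * x" and f2: "f (HD c - 1) = 1 - x / q"
    using HD_adjacent_corner[OF y b c] ne power_int_add[of q "HD c - HD b" 1] power_int_diff[of q "HD c - HD b" 1]
    by (auto simp: f_def x_def algebra_simps)
  have PA: "(\<Prod>a\<in>addable X. f (HD a)) = (\<Prod>a\<in>addable X - {b}. 1 - q powi (HD a - HD b))"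
    if "young X" "b \<in> addable X" for X
  proof -
    have "(\<Prod>a\<in>addable X. f (HD a)) = f (HD b) * (\<Prod>a\<in>addable X - {b}. f (HD a))"
      using that finite_addable by (intro prod.remove) auto
    also have "\<dots> = (\<Prod>a\<in>addable X - {b}. 1 - q powi (HD a - HD b))"
      using inj_on_HD_addable[OF that(1)] that(2)
      by (simp add: f_def) (rule prod.cong, auto simp: inj_on_def)
    finally show ?thesis .
  qed
  have PC: "(\<Prod>a\<in>corners X. f (HD a)) = (\<Prod>a\<in>corners X. 1 - q powi (HD a - HD b))"
    if "young X" "b \<in> addable X" for X
    using HD_corner_neq_addable[OF that] by (intro prod.cong) (auto simp: f_def)
  have fc: "f (HD c) = 1 - x" using cb by (simp add: f_def x_def)
  have RA: "(\<Prod>a\<in>addable (D - {c}). f (HD a)) = (1 - x) * (\<Prod>a\<in>addable (D - {c}) - {c}. f (HD a))"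
    using c1 finite_addable[OF y1] by (subst prod.remove[of _ c]) (auto simp: fc)
  have RC: "(\<Prod>a\<in>corners D. f (HD a)) = (1 - x) * (\<Prod>a\<in>corners D - {c}. f (HD a))"
    using c finite_corners[OF y] by (subst prod.remove[of _ c]) (auto simp: fc)
  have "(\<Prod>a\<in>addable D. f (HD a)) * (\<Prod>a\<in>corners (D - {c}). f (HD a)) * (1 - x)\<^sup>2 =
     (\<Prod>a\<in>addable (D - {c}). f (HD a)) * (\<Prod>a\<in>corners D. f (HD a)) * ((1 - q * x) * (1 - x / q))"
    using prod_addable_corners_insert[OF y1 c1, of f] unfolding ins f1 f2 RA RC
    by (simp add: power2_eq_square mult_ac)
  then show ?thesis
    unfolding PA[OF y b] PA[OF y1 b1] PC[OF y b] PC[OF y1 b1] ecoef_def Ffun_eq x_def[symmetric]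
    using prod_corners_nz[OF y b] prod_corners_nz[OF y1 b1] x by (simp add: field_simps)
qed

text \<open>
  Matrix entries of the inverse of a generator.  When the two boxes are aligned, they are adjacent and the
  generic diagonal entry specialises to the inverse of \<open>\<alpha>\<close> or \<open>\<beta>\<close>.
\<close>
definition tco :: "box \<Rightarrow> box \<Rightarrow> complex" where
  "tco c d = ((\<alpha> + \<beta>) - (\<alpha> + \<beta>) / (1 - q powi (HD d - HD c))) / (\<alpha> * \<beta>)"

definition sco :: "box \<Rightarrow> box \<Rightarrow> complex" where
  "sco c d = (if fst c = fst d \<or> snd c = snd d then 0
     else - eta P (q powi (HD d - HD c)) / (\<alpha> * \<beta>))"

text \<open>Since \<beta> = - q \<alpha>, the entry \<open>tco\<close> equals
  \<open>(1 - q) / (q * \<alpha>)\<close> times \<open>x / (1 - x)\<close>. This is the shape in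
  which the terms of \<open>partial_fractions\<close> appear.\<close>

lemma tco_mult:
  assumes "HD d \<noteq> HD b" "HD d \<noteq> HD b'"
  shows "- (\<alpha> * \<beta>) * (tco b d * tco b' d) =
    - ((1 - q) * (1 - 1 / q)) * (q powi (HD d - HD b) / (1 - q powi (HD d - HD b)) *
      (q powi (HD d - HD b') / (1 - q powi (HD d - HD b'))))"
proof -
  have aux: "((\<alpha> + \<beta>) - (\<alpha> + \<beta>) / (1 - x)) / (\<alpha> * \<beta>) = (1 - q) / (q * \<alpha>) * (x / (1 - x))"
    if "x \<noteq> 1" for x
    unfolding beta_eq using that nz(1) q_nz by (simp add: divide_simps) algebra
  have "q powi (HD d - HD b) \<noteq> 1" "q powi (HD d - HD b') \<noteq> 1" using assms by auto
  note * = aux[OF this(1)] aux[OF this(2)]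
  have "- (\<alpha> * \<beta>) * ((1 - q) / (q * \<alpha>) * x * ((1 - q) / (q * \<alpha>) * y)) =
      - ((1 - q) * (1 - 1 / q)) * (x * y)" for x y
    unfolding beta_eq using nz(1) q_nz by (simp add: divide_simps) algebra
  then show ?thesis unfolding tco_def * .
qed

text \<open>The two arguments of \<eta> are reciprocal, so the functional equation applies. The
  resulting scalar is the one that \<open>ecoef_remove_corner\<close> produces when a non-aligned
  corner is removed.\<close>

lemma sco_mult:
  assumes "fst b \<noteq> fst c" "snd b \<noteq> snd c" "HD b \<noteq> HD c"
  shows "- (\<alpha> * \<beta>) * (sco c b * sco b c) = Ffun P (q powi (HD c - HD b))"
proof -
  let ?x = "q powi (HD c - HD b)"
  have i: "q powi (HD b - HD c) = 1 / ?x"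
    using power_int_minus[of q "HD c - HD b"] by (simp add: field_simps)
  have "?x \<noteq> 0" "?x \<noteq> 1" using assms(3) by auto
  then have "eta P ?x * eta P (1 / ?x) = - \<alpha> * \<beta> * Ffun P ?x"
    using ez unfolding eta_zeta_ok_def by blast
  then show ?thesis using assms unfolding sco_def i by (simp add: field_simps)
qed

text \<open>Adding \<open>c\<close> to \<open>D - {c}\<close> contributes the contents
  \<open>HD c + 1\<close> and \<open>HD c - 1\<close>, that is, the factors \<open>1 - q\<close> and
  \<open>1 - 1 / q\<close>. The right-hand side is, up to the factor of one addable box, a
  coefficient of the partial fraction expansion for \<open>D\<close>; so these coefficients are
  values of \<open>ecoef\<close> one level below.\<close>

lemma ecoef_at_corner:
  assumes "young D" "c \<in> corners D"
  shows "(1 - q) * (1 - 1 / q) * ecoef c (D - {c}) =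
    (\<Prod>a\<in>addable D. 1 - q powi (HD a - HD c)) / (\<Prod>d\<in>corners D - {c}. 1 - q powi (HD d - HD c))"
proof -
  have y1: "young (D - {c})" using young_remove_corner[OF assms(2)] .
  have c1: "c \<in> addable (D - {c})" using addable_remove_corner[OF assms] .
  have ins: "insert c (D - {c}) = D" using corner_in[OF assms(2)] by auto
  have "(\<Prod>d\<in>corners D - {c}. 1 - q powi (HD d - HD c)) \<noteq> 0"
    using finite_corners[OF assms(1)] inj_on_HD_corners[OF assms(1)] assms(2) by (auto simp: inj_on_def)
  moreover have "q powi (HD c + 1 - HD c) = q" "q powi (HD c - 1 - HD c) = 1 / q"
    by (simp_all add: power_int_minus field_simps)
  ultimately show ?thesis
    using prod_addable_corners_insert[OF y1 c1, of "\<lambda>k. 1 - q powi (k - HD c)"] prod_corners_nz[OF y1 c1]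
    unfolding ecoef_def ins by (simp add: divide_simps mult_ac)
qed

text \<open>A partial fraction expansion with zeros at the addable boxes other than \<open>b\<close>
  and poles at the corners; the hypothesis on cardinalities makes these equally many. It is
  evaluated at the point of \<open>b'\<close>: for \<open>b \<noteq> b'\<close> that point is a
  zero, for \<open>b = b'\<close> the quotient is \<open>ecoef b D\<close>.\<close>

lemma sum_ecoef:
  assumes y: "young D" and card: "card (addable D) = card (corners D) + 1"
    and b: "b \<in> addable D" and b': "b' \<in> addable D"
  shows "1 + - (\<alpha> * \<beta>) * (\<Sum>d\<in>corners D. tco b d * tco b' d * ecoef d (D - {d})) =
    (if b = b' then ecoef b D else 0)"
proof -
  let ?v = "\<lambda>x. q powi HD x"
  let ?A = "addable D - {b}" and ?C = "corners D"
  define z where "z = 1 / ?v b'"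
  have fin: "finite ?A" "finite ?C" using finite_addable[OF y] finite_corners[OF y] by auto
  have cd: "card ?A = card ?C" using card b fin by simp
  have inj: "inj_on ?v ?C" using inj_on_HD_corners[OF y] by (auto simp: inj_on_def)
  have vz: "?v x * z = q powi (HD x - HD b')" for x by (simp add: z_def power_int_diff)
  have vd: "?v x / ?v w = q powi (HD x - HD w)" for x w by (simp add: power_int_diff)
  have zne: "?v c * z \<noteq> 1" if "c \<in> ?C" for c
    using HD_corner_neq_addable[OF y b' that] by (simp add: vz)
  have pf: "(\<Prod>a\<in>?A. 1 - ?v a * z) / (\<Prod>c\<in>?C. 1 - ?v c * z) =
     1 + (\<Sum>c\<in>?C. (\<Prod>a\<in>?A. 1 - ?v a / ?v c) / (\<Prod>d\<in>?C - {c}. 1 - ?v d / ?v c) * (?v c * z / (1 - ?v c * z)))"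
    by (rule partial_fractions[OF fin cd inj _ zne]) auto
  have L: "(\<Prod>a\<in>?A. 1 - ?v a * z) / (\<Prod>c\<in>?C. 1 - ?v c * z) = (if b = b' then ecoef b D else 0)"
  proof (cases "b = b'")
    case True
    then show ?thesis by (simp add: vz ecoef_def)
  next
    case False
    then have "b' \<in> ?A" using b' by auto
    then have "(\<Prod>a\<in>?A. 1 - ?v a * z) = 0" using fin by (auto simp: vz)
    then show ?thesis using False by simp
  qed
  have T: "(\<Prod>a\<in>?A. 1 - ?v a / ?v c) / (\<Prod>d\<in>?C - {c}. 1 - ?v d / ?v c) * (?v c * z / (1 - ?v c * z)) =
     - (\<alpha> * \<beta>) * (tco b c * tco b' c * ecoef c (D - {c}))" if c: "c \<in> ?C" for c
  proof -
    have ne: "HD c \<noteq> HD b" "HD c \<noteq> HD b'" using HD_corner_neq_addable[OF y _ c] b b' by auto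
    define w where "w = q powi (HD c - HD b)"
    have w: "w \<noteq> 0" "w \<noteq> 1" using ne by (auto simp: w_def)
    have "q powi (HD b - HD c) = 1 / w"
      using power_int_minus[of q "HD c - HD b"] by (simp add: w_def field_simps)
    then have "(\<Prod>a\<in>addable D. 1 - q powi (HD a - HD c)) = (1 - 1 / w) * (\<Prod>a\<in>?A. 1 - q powi (HD a - HD c))"
      using finite_addable[OF y] b by (subst prod.remove[of _ b]) auto
    \<comment> \<open>Completing the product by the factor of \<open>b\<close> costs
      \<open>- (w / (1 - w))\<close>. This supplies the factor of \<open>tco b c\<close>, while the
      pole term at \<open>z\<close> supplies that of \<open>tco b' c\<close>.\<close>
    then have pa: "(\<Prod>a\<in>?A. 1 - q powi (HD a - HD c)) = - (w / (1 - w)) * (\<Prod>a\<in>addable D. 1 - q powi (HD a - HD c))"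
      using w by (simp add: divide_simps) algebra
    have "(\<Prod>a\<in>?A. 1 - ?v a / ?v c) / (\<Prod>d\<in>?C - {c}. 1 - ?v d / ?v c) =
       - (w / (1 - w)) * ((1 - q) * (1 - 1 / q) * ecoef c (D - {c}))"
      unfolding vd pa ecoef_at_corner[OF y c] by simp
    moreover have "- (\<alpha> * \<beta>) * (tco b c * tco b' c * ecoef c (D - {c})) =
      - (\<alpha> * \<beta>) * (tco b c * tco b' c) * ecoef c (D - {c})" by simp
    ultimately show ?thesis
      unfolding tco_mult[OF ne] vz w_def by simp
  qed
  have "(\<Sum>c\<in>?C. (\<Prod>a\<in>?A. 1 - ?v a / ?v c) / (\<Prod>d\<in>?C - {c}. 1 - ?v d / ?v c) * (?v c * z / (1 - ?v c * z))) =
     - (\<alpha> * \<beta>) * (\<Sum>c\<in>?C. tco b c * tco b' c * ecoef c (D - {c}))"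
    unfolding sum_distrib_left by (rule sum.cong[OF refl T])
  then show ?thesis using pf unfolding L by simp
qed


text \<open>
  Elements of the Hecke algebra act on the span of the standard paths; here they act contravariantly
  on arbitrary functions of paths, so that no finiteness conditions arise.  A path lists the boxes of
  a standard tableau starting with the largest entry, hence \<^term>\<open>hinv_fun i\<close> is the transpose
  of the inverse of the generator with index \<^term>\<open>i + 1\<close>.
\<close>
primrec hinv_fun :: "nat \<Rightarrow> (box list \<Rightarrow> complex) \<Rightarrow> box list \<Rightarrow> complex" where
  "hinv_fun 0 F L = (case L of c # d # U \<Rightarrow> tco c d * F (c # d # U) + sco c d * F (d # c # U) | _ \<Rightarrow> F L)"
| "hinv_fun (Suc i) F L = (case L of c # U \<Rightarrow> hinv_fun i (\<lambda>V. F (c # V)) U | [] \<Rightarrow> F [])"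

text \<open>\<open>Rfun\<close> and \<open>Lfun\<close> are the transposes of \<open>Rh\<close> and
  \<open>Lh\<close>. Transposition reverses products, so each recursion nests in the opposite way to
  its operator counterpart.\<close>

primrec Rfun :: "nat \<Rightarrow> (box list \<Rightarrow> complex) \<Rightarrow> box list \<Rightarrow> complex" where
  "Rfun 0 F = F"
| "Rfun (Suc k) F = hinv_fun k (Rfun k F)"

primrec Lfun :: "nat \<Rightarrow> (box list \<Rightarrow> complex) \<Rightarrow> box list \<Rightarrow> complex" where
  "Lfun 0 F = F"
| "Lfun (Suc k) F = Lfun k (hinv_fun k F)"

text \<open>Non-standard paths never contribute: an exchange that leaves the standard paths involves
  aligned boxes, for which \<open>sco\<close> is 0, and any other exchange keeps the set of
  boxes.\<close>

lemma hinv_fun_cong: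
  assumes "std_path L" "\<And>L'. std_path L' \<Longrightarrow> set L' = set L \<Longrightarrow> F L' = G L'"
  shows "hinv_fun i F L = hinv_fun i G L"
  using assms
proof (induction i arbitrary: F G L)
  case 0
  show ?case
  proof (cases "\<exists>c d U. L = c # d # U")
    case True
    then obtain c d U where L: "L = c # d # U" by blast
    have "sco c d * F (d # c # U) = sco c d * G (d # c # U)"
    proof (cases "fst c = fst d \<or> snd c = snd d")
      case False
      then have "std_path (d # c # U)" using std_path_swap 0(1) L by blast
      then show ?thesis using 0(2)[of "d # c # U"] L by (simp add: insert_commute)
    qed (auto simp: sco_def)
    then show ?thesis using 0 L by simp
  next
    case False
    then show ?thesis using 0 by (auto split: list.splits)
  qed
next
  case (Suc i)
  show ?case
  proof (cases L)
    case (Cons c U)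
    have "hinv_fun i (\<lambda>V. F (c # V)) U = hinv_fun i (\<lambda>V. G (c # V)) U"
      using Suc.prems Cons by (intro Suc.IH) auto
    then show ?thesis using Cons by simp
  qed (use Suc.prems in auto)
qed

lemma Rfun_cong:
  assumes "std_path L" "\<And>L'. std_path L' \<Longrightarrow> set L' = set L \<Longrightarrow> F L' = G L'"
  shows "Rfun i F L = Rfun i G L"
  using assms
proof (induction i arbitrary: L)
  case (Suc i)
  show ?case unfolding Rfun.simps
    by (rule hinv_fun_cong[OF Suc.prems(1)]) (use Suc in auto)
qed simp

lemma Lfun_cong:
  assumes "std_path L" "\<And>L'. std_path L' \<Longrightarrow> set L' = set L \<Longrightarrow> F L' = G L'"
  shows "Lfun i F L = Lfun i G L"
  using assms
proof (induction i arbitrary: F G)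
  case (Suc i)
  show ?case unfolding Lfun.simps
  proof (rule Suc.IH[OF Suc.prems(1)])
    fix L' assume "std_path L'" "set L' = set L"
    then show "hinv_fun i F L' = hinv_fun i G L'"
      using Suc.prems(2) by (intro hinv_fun_cong) auto
  qed
qed simp

lemma hinv_fun_sum:
  "hinv_fun i (\<lambda>V. \<Sum>k\<in>K. a k * G k V) L = (\<Sum>k\<in>K. a k * hinv_fun i (G k) L)"
proof (induction i arbitrary: G L)
  case 0
  show ?case by (auto split: list.splits simp: sum_distrib_left sum.distrib algebra_simps)
next
  case (Suc i)
  show ?case using Suc.IH by (auto split: list.splits)
qed

lemma Rfun_sum:
  "Rfun i (\<lambda>V. \<Sum>k\<in>K. a k * G k V) L = (\<Sum>k\<in>K. a k * Rfun i (G k) L)"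
proof (induction i arbitrary: L)
  case (Suc i)
  have "Rfun i (\<lambda>V. \<Sum>k\<in>K. a k * G k V) = (\<lambda>V. \<Sum>k\<in>K. a k * Rfun i (G k) V)"
    using Suc.IH by auto
  then show ?case by (simp add: hinv_fun_sum)
qed simp

lemma Rfun_add:
  "Rfun i (\<lambda>V. F V + G V) L = Rfun i F L + Rfun i G L"
  using Rfun_sum[of i "\<lambda>_. 1" "\<lambda>k. if k then F else G" UNIV L] by (simp add: UNIV_bool add.commute)

lemma Rfun_scale:
  "Rfun i (\<lambda>V. x * F V) L = x * Rfun i F L"
  using Rfun_sum[of i "\<lambda>_. x" "\<lambda>_. F" "{()}" L] by simp

text \<open>Only \<open>hinv_fun 0\<close> touches the head of the path. The generators with larger
  index act on the tail as the generators one index lower, so the head can be split off.\<close>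

lemma Rfun_Suc_Cons: "Rfun (Suc i) G (c # U) = Rfun i (\<lambda>V. hinv_fun 0 G (c # V)) U"
proof (induction i arbitrary: U)
  case (Suc i)
  have "Rfun (Suc (Suc i)) G (c # U) = hinv_fun i (\<lambda>V. Rfun (Suc i) G (c # V)) U"
    by simp
  then show ?case using Suc.IH by (simp only: Rfun.simps)
qed simp

text \<open>Counterpart of \<open>Rfun_Suc_Cons\<close> on the other side. Together they turn a
  summand of the relative trace into a summand for the tail, in which the middle operator is
  enclosed between two copies of the first inverse generator.\<close>

lemma Lfun_Suc:
  "Lfun (Suc i) F = hinv_fun 0 (\<lambda>L. case L of c # U \<Rightarrow> Lfun i (\<lambda>V. F (c # V)) U | [] \<Rightarrow> F [])"
proof (induction i arbitrary: F)
  case 0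
  have "(\<lambda>L. case L of c # U \<Rightarrow> F (c # U) | [] \<Rightarrow> F []) = F" by (auto split: list.splits)
  then show ?case by (simp only: Lfun.simps)
next
  case (Suc i)
  have "Lfun (Suc (Suc i)) F = Lfun (Suc i) (hinv_fun (Suc i) F)" by simp
  also have "\<dots> = hinv_fun 0 (\<lambda>L. case L of c # U \<Rightarrow> Lfun i (\<lambda>V. hinv_fun (Suc i) F (c # V)) U
     | [] \<Rightarrow> hinv_fun (Suc i) F [])" by (rule Suc.IH)
  also have "\<dots> = hinv_fun 0 (\<lambda>L. case L of c # U \<Rightarrow> Lfun (Suc i) (\<lambda>V. F (c # V)) U | [] \<Rightarrow> F [])"
    by (rule arg_cong[of _ _ "hinv_fun 0"]) (auto split: list.splits)
  finally show ?case .
qed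

section \<open>The relative trace of the operators moving the last box\<close>

definition move_hd :: "box \<Rightarrow> box \<Rightarrow> (box list \<Rightarrow> complex) \<Rightarrow> box list \<Rightarrow> complex" where
  "move_hd b b' F L = (case L of c # U \<Rightarrow> if c = b then F (b' # U) else 0 | [] \<Rightarrow> 0)"

text \<open>The sum in the element with index n + 1, for an arbitrary middle operator
  \<open>X\<close> in place of \<open>E\<close>. The index starts at 0, so the exponent i - 1
  becomes i.\<close>

definition rel_trace :: "nat \<Rightarrow> ((box list \<Rightarrow> complex) \<Rightarrow> box list \<Rightarrow> complex) \<Rightarrow> (box list \<Rightarrow> complex) \<Rightarrow> box list \<Rightarrow> complex" where
  "rel_trace n X F L = (\<Sum>i<n. (- (\<alpha> * \<beta>)) ^ i * Rfun i (X (Lfun i F)) L)"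

lemma rel_trace_Suc:
  "rel_trace (Suc n) X F (c # U) = X F (c # U) + - (\<alpha> * \<beta>) *
     (\<Sum>i<n. (- (\<alpha> * \<beta>)) ^ i * Rfun i (\<lambda>V. hinv_fun 0 (X (Lfun (Suc i) F)) (c # V)) U)"
  unfolding rel_trace_def sum.lessThan_Suc_shift Rfun_Suc_Cons
  by (simp add: sum_distrib_left mult_ac del: Lfun.simps(2))

text \<open>Induction on the path, splitting off its head \<open>c\<close>. For \<open>c = b\<close>
  the first inverse generators leave operators fixing a corner \<open>d\<close> of \<open>D\<close>,
  summed by \<open>sum_ecoef\<close>. For \<open>c \<noteq> b\<close> only the double exchange of
  \<open>b\<close> and \<open>c\<close> survives, and \<open>ecoef_remove_corner\<close> matches the
  scalar \<open>sco_mult\<close>.\<close>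

lemma rel_trace_move_hd:
  assumes "std_path L" "set L = insert b D" "young D" "b \<in> addable D" "b' \<in> addable D"
  shows "rel_trace (length L) (move_hd b b') F L = (if b = b' then ecoef b D * F L else 0)"
  using assms
proof (induction L arbitrary: b b' D F)
  case Nil
  then show ?case by simp
next
  case (Cons c U)
  note b = \<open>b \<in> addable D\<close> and b' = \<open>b' \<in> addable D\<close> and y = \<open>young D\<close>
  have stdU: "std_path U" and cU: "c \<in> addable (set U)" and cnU: "c \<notin> set U"
    using Cons.prems(1) addable_notin by auto
  have bD: "b \<notin> D" "b' \<notin> D" using b b' addable_notin by auto
  show ?case
  proof (cases "c = b")
    case True
    have D: "set U = D" using Cons.prems(2) True cnU bD by auto
    have cd: "card (addable D) = card (corners D) + 1" using card_addable[OF stdU] D by simp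
    \<comment> \<open>In the outer generator the exchange term vanishes, because it puts
      \<open>d \<noteq> b\<close> in front and \<open>move_hd\<close> requires \<open>b\<close>. The
      inner generator then either keeps \<open>b'\<close> in front of \<open>d\<close> or exchanges
      them.\<close>
    have step: "Rfun i (\<lambda>V. hinv_fun 0 (move_hd b b' (Lfun (Suc i) F)) (c # V)) U =
       (\<Sum>d\<in>corners D. (tco b d * tco b' d) * Rfun i (move_hd d d (Lfun i (\<lambda>V. F (b' # V)))) U
          + (tco b d * sco b' d) * Rfun i (move_hd d b' (Lfun i (\<lambda>V. F (d # V)))) U)"
      if "i < length U" for i
    proof -
      have "Rfun i (\<lambda>V. hinv_fun 0 (move_hd b b' (Lfun (Suc i) F)) (c # V)) U =
        Rfun i (\<lambda>V. (\<Sum>d\<in>corners D. (tco b d * tco b' d) * move_hd d d (Lfun i (\<lambda>V. F (b' # V))) V)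
          + (\<Sum>d\<in>corners D. (tco b d * sco b' d) * move_hd d b' (Lfun i (\<lambda>V. F (d # V))) V)) U"
      proof (rule Rfun_cong[OF stdU])
        fix V assume V: "std_path V" "set V = set U"
        have "V \<noteq> []" using V(2) that by auto
        then obtain d W where VW: "V = d # W" by (cases V) auto
        have d: "d \<in> corners D" using std_path_hd_corner[of d W] V D VW by simp
        have db: "d \<noteq> b" using corner_in[OF d] bD by auto
        have fin: "finite (corners D)" using finite_corners[OF y] .
        have pick: "(\<Sum>x\<in>corners D. G x * (if d = x then H x else 0)) = G d * H d" for G H :: "box \<Rightarrow> complex"
        proof -
          have "(\<Sum>x\<in>corners D. G x * (if d = x then H x else 0)) = (\<Sum>x\<in>corners D. if d = x then G x * H x else 0)"
            by (rule sum.cong) auto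
          then show ?thesis using fin d by simp
        qed
        have "(\<Sum>d\<in>corners D. (tco b d * tco b' d) * move_hd d d (Lfun i (\<lambda>V. F (b' # V))) V) =
            tco b d * tco b' d * Lfun i (\<lambda>V. F (b' # V)) (d # W)"
          and "(\<Sum>d\<in>corners D. (tco b d * sco b' d) * move_hd d b' (Lfun i (\<lambda>V. F (d # V))) V) =
            tco b d * sco b' d * Lfun i (\<lambda>V. F (d # V)) (b' # W)"
          by (simp_all add: VW move_hd_def pick)
        then show "hinv_fun 0 (move_hd b b' (Lfun (Suc i) F)) (c # V) =
          (\<Sum>d\<in>corners D. (tco b d * tco b' d) * move_hd d d (Lfun i (\<lambda>V. F (b' # V))) V)
          + (\<Sum>d\<in>corners D. (tco b d * sco b' d) * move_hd d b' (Lfun i (\<lambda>V. F (d # V))) V)"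
          unfolding Lfun_Suc using db True by (simp add: VW move_hd_def algebra_simps)
      qed
      then show ?thesis by (simp add: Rfun_add Rfun_sum sum.distrib)
    qed
    have t1: "rel_trace (length U) (move_hd d d) (\<lambda>V. F (b' # V)) U = ecoef d (D - {d}) * F (b' # U)"
      if d: "d \<in> corners D" for d
      using Cons.IH[OF stdU, of d "D - {d}" d] addable_remove_corner[OF y d] young_remove_corner[OF d]
        corner_in[OF d] D by (simp add: insert_absorb)
    \<comment> \<open>Either \<open>b'\<close> is aligned with \<open>d\<close> and the coefficient
      is 0, or \<open>b'\<close> is addable to \<open>D - {d}\<close> and the induction hypothesis
      applies to the distinct boxes \<open>d\<close> and \<open>b'\<close>.\<close>
    have t2: "sco b' d * rel_trace (length U) (move_hd d b') (\<lambda>V. F (d # V)) U = 0"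
      if d: "d \<in> corners D" for d
    proof (cases "fst b' = fst d \<or> snd b' = snd d")
      case False
      then have "b' \<in> addable (D - {d})" using addable_after_removing_corner[OF y b' d] by blast
      moreover have "d \<noteq> b'" using corner_in[OF d] bD by auto
      ultimately show ?thesis
        using Cons.IH[OF stdU, of d "D - {d}" b'] addable_remove_corner[OF y d] young_remove_corner[OF d]
          corner_in[OF d] D by (simp add: insert_absorb)
    qed (auto simp: sco_def)
    have "(\<Sum>i<length U. (- (\<alpha> * \<beta>)) ^ i * Rfun i (\<lambda>V. hinv_fun 0 (move_hd b b' (Lfun (Suc i) F)) (c # V)) U) =
      (\<Sum>i<length U. \<Sum>d\<in>corners D. (- (\<alpha> * \<beta>)) ^ i *
         ((tco b d * tco b' d) * Rfun i (move_hd d d (Lfun i (\<lambda>V. F (b' # V)))) U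
          + (tco b d * sco b' d) * Rfun i (move_hd d b' (Lfun i (\<lambda>V. F (d # V)))) U))"
      using step by (simp add: sum_distrib_left)
    also have "\<dots> = (\<Sum>d\<in>corners D. \<Sum>i<length U. (- (\<alpha> * \<beta>)) ^ i *
         ((tco b d * tco b' d) * Rfun i (move_hd d d (Lfun i (\<lambda>V. F (b' # V)))) U
          + (tco b d * sco b' d) * Rfun i (move_hd d b' (Lfun i (\<lambda>V. F (d # V)))) U))"
      by (rule sum.swap)
    also have "\<dots> = (\<Sum>d\<in>corners D. (tco b d * tco b' d) * rel_trace (length U) (move_hd d d) (\<lambda>V. F (b' # V)) U
        + tco b d * (sco b' d * rel_trace (length U) (move_hd d b') (\<lambda>V. F (d # V)) U))"
      unfolding rel_trace_def sum_distrib_left sum.distrib[symmetric] by (simp add: algebra_simps)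
    also have "\<dots> = (\<Sum>d\<in>corners D. (tco b d * tco b' d) * (ecoef d (D - {d}) * F (b' # U)))"
      by (rule sum.cong[OF refl]) (simp only: t1 t2 mult_zero_right add_0_right)
    also have "\<dots> = (\<Sum>d\<in>corners D. tco b d * tco b' d * ecoef d (D - {d})) * F (b' # U)"
      unfolding sum_distrib_right by (simp add: mult.assoc)
    finally have "rel_trace (length (c # U)) (move_hd b b') F (c # U) =
      (1 + - (\<alpha> * \<beta>) * (\<Sum>d\<in>corners D. tco b d * tco b' d * ecoef d (D - {d}))) * F (b' # U)"
      using True by (simp add: rel_trace_Suc move_hd_def algebra_simps del: Lfun.simps(2) hinv_fun.simps(1))
    then show ?thesis unfolding sum_ecoef[OF y cd b b'] using True by simp
  next
    case False
    have cD: "c \<in> D" using Cons.prems(2) False by auto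
    have sU: "set U = insert b (D - {c})" using Cons.prems(2) cnU False by auto
    have y': "young (insert b D)" using young_insert_addable[OF b] .
    have cc: "c \<in> corners (insert b D)" using std_path_hd_corner[OF Cons.prems(1)] Cons.prems(2) by simp
    have ne: "fst b \<noteq> fst c" "snd b \<noteq> snd c"
      using two_corners_not_aligned[OF y' corner_insert_addable[OF y b] cc] False by auto
    have c: "c \<in> corners D"
      using corners_iff[OF y] corners_iff[OF y'] cc cD by (cases c) auto
    have b1: "b \<in> addable (D - {c})" using addable_after_removing_corner[OF y b c ne] .
    have c1: "c \<in> addable (D - {c})" using addable_remove_corner[OF y c] .
    have y1: "young (D - {c})" using young_remove_corner[OF c] .
    \<comment> \<open>Here the roles are reversed: with \<open>c \<noteq> b\<close> in front,
      \<open>move_hd\<close> kills the diagonal term of the outer generator, and only the exchange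
      that brings a following \<open>b\<close> to the front contributes.\<close>
    have step: "Rfun i (\<lambda>V. hinv_fun 0 (move_hd b b' (Lfun (Suc i) F)) (c # V)) U =
       (sco c b * tco b' c) * Rfun i (move_hd b c (Lfun i (\<lambda>V. F (b' # V)))) U
          + (sco c b * sco b' c) * Rfun i (move_hd b b' (Lfun i (\<lambda>V. F (c # V)))) U"
      for i
    proof -
      have "Rfun i (\<lambda>V. hinv_fun 0 (move_hd b b' (Lfun (Suc i) F)) (c # V)) U =
        Rfun i (\<lambda>V. (sco c b * tco b' c) * move_hd b c (Lfun i (\<lambda>V. F (b' # V))) V
          + (sco c b * sco b' c) * move_hd b b' (Lfun i (\<lambda>V. F (c # V))) V) U"
      proof (rule Rfun_cong[OF stdU])
        fix V assume V: "std_path V" "set V = set U"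
        have "V \<noteq> []" using V(2) sU by auto
        then obtain d W where VW: "V = d # W" by (cases V) auto
        show "hinv_fun 0 (move_hd b b' (Lfun (Suc i) F)) (c # V) =
          (sco c b * tco b' c) * move_hd b c (Lfun i (\<lambda>V. F (b' # V))) V
          + (sco c b * sco b' c) * move_hd b b' (Lfun i (\<lambda>V. F (c # V))) V"
          unfolding Lfun_Suc using False by (simp add: VW move_hd_def algebra_simps)
      qed
      then show ?thesis by (simp add: Rfun_add Rfun_scale)
    qed
    have t1: "rel_trace (length U) (move_hd b c) (\<lambda>V. F (b' # V)) U = 0"
      using Cons.IH[OF stdU sU y1 b1 c1] False by simp
    have t2: "sco b' c * rel_trace (length U) (move_hd b b') (\<lambda>V. F (c # V)) U =
       (if b = b' then sco b c * (ecoef b (D - {c}) * F (c # U)) else 0)"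
    proof (cases "fst b' = fst c \<or> snd b' = snd c")
      case True
      then show ?thesis using ne by (auto simp: sco_def)
    next
      case False
      then have "b' \<in> addable (D - {c})" using addable_after_removing_corner[OF y b' c] by blast
      then show ?thesis using Cons.IH[OF stdU sU y1 b1, of b'] by simp
    qed
    have "(\<Sum>i<length U. (- (\<alpha> * \<beta>)) ^ i * Rfun i (\<lambda>V. hinv_fun 0 (move_hd b b' (Lfun (Suc i) F)) (c # V)) U) =
      (sco c b * tco b' c) * rel_trace (length U) (move_hd b c) (\<lambda>V. F (b' # V)) U
        + sco c b * (sco b' c * rel_trace (length U) (move_hd b b') (\<lambda>V. F (c # V)) U)"
      unfolding step rel_trace_def sum_distrib_left sum.distrib[symmetric] by (simp add: algebra_simps)
    then have "rel_trace (length (c # U)) (move_hd b b') F (c # U) =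
      (if b = b' then - (\<alpha> * \<beta>) * (sco c b * sco b c) * ecoef b (D - {c}) * F (c # U) else 0)"
      using False by (simp add: rel_trace_Suc move_hd_def t1 t2 del: Lfun.simps(2) hinv_fun.simps(1))
    then show ?thesis
      unfolding sco_mult[OF ne HD_corner_neq_addable[OF y b c, symmetric]] ecoef_remove_corner[OF y b c ne] .
  qed
qed

end

section \<open>Tableaux as paths\<close>

lemma rc_incrD:
  assumes "rc_incr T D" "(i, j) \<in> D" "(i', j') \<in> D" "(i = i' \<and> j < j') \<or> (j = j' \<and> i < i')"
  shows "T (i, j) < T (i', j')"
  using bspec[OF bspec[OF assms(1)[unfolded rc_incr_def] assms(2), unfolded prod.case] assms(3)] assms(4)
  by auto

lemma rc_incrI:
  assumes "\<And>i j i' j'. (i, j) \<in> D \<Longrightarrow> (i', j') \<in> D \<Longrightarrow> (i = i' \<and> j < j') \<or> (j = j' \<and> i < i')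
    \<Longrightarrow> T (i, j) < T (i', j')"
  shows "rc_incr T D"
  unfolding rc_incr_def split_beta
proof (intro ballI impI)
  fix x y assume "x \<in> D" "y \<in> D" "fst x = fst y \<and> snd x < snd y \<or> snd x = snd y \<and> fst x < fst y"
  then show "T (fst x, snd x) < T (fst y, snd y)" using assms[of "fst x" "snd x" "fst y" "snd y"] by simp
qed

lemma rc_decrD:
  assumes "rc_decr T D" "(i, j) \<in> D" "(i', j') \<in> D" "(i = i' \<and> j < j') \<or> (j = j' \<and> i < i')"
  shows "T (i, j) > T (i', j')"
  using bspec[OF bspec[OF assms(1)[unfolded rc_decr_def] assms(2), unfolded prod.case] assms(3)] assms(4)
  by auto

lemma rc_decrI:
  assumes "\<And>i j i' j'. (i, j) \<in> D \<Longrightarrow> (i', j') \<in> D \<Longrightarrow> (i = i' \<and> j < j') \<or> (j = j' \<and> i < i')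
    \<Longrightarrow> T (i, j) > T (i', j')"
  shows "rc_decr T D"
  unfolding rc_decr_def split_beta
proof (intro ballI impI)
  fix x y assume "x \<in> D" "y \<in> D" "fst x = fst y \<and> snd x < snd y \<or> snd x = snd y \<and> fst x < fst y"
  then show "T (fst x, snd x) > T (fst y, snd y)" using assms[of "fst x" "snd x" "fst y" "snd y"] by simp
qed

primrec path_tab :: "box list \<Rightarrow> tab" where
  "path_tab [] = (\<lambda>_. 0)"
| "path_tab (b # L) = (path_tab L)(b := Suc (length L))"

lemma path_tab_le: "path_tab L b \<le> length L"
  by (induction L) (auto simp: le_Suc_eq)

lemma path_tab_eq_0_iff: "path_tab L b = 0 \<longleftrightarrow> b \<notin> set L"
  by (induction L) auto

lemma shape_path_tab: "shape (path_tab L) = set L"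
  by (auto simp: shape_def path_tab_eq_0_iff)

lemma bij_betw_path_tab:
  assumes "distinct L"
  shows "bij_betw (path_tab L) (set L) {1..length L}"
  using assms
proof (induction L)
  case (Cons b L)
  have "bij_betw (path_tab (b # L)) (set L) {1..length L}"
    by (rule bij_betw_cong[THEN iffD1, OF _ Cons.IH]) (use Cons.prems in auto)
  then have "bij_betw (path_tab (b # L)) (insert b (set L)) (insert (path_tab (b # L) b) {1..length L})"
    using notIn_Un_bij_betw[of b "set L" "path_tab (b # L)" "{1..length L}"] Cons.prems by simp
  moreover have "insert (path_tab (b # L) b) {1..length L} = {1..length (b # L)}" by auto
  ultimately show ?case by (metis list.simps(15))
qed (simp add: bij_betw_def)

lemma pos_path_tab:
  assumes "distinct (xs @ b # ys)"
  shows "pos (path_tab (xs @ b # ys)) (Suc (length ys)) = b"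
proof -
  have v: "path_tab (xs @ b # ys) b = Suc (length ys)"
    using assms by (induction xs) auto
  have "x = b" if "path_tab (xs @ b # ys) x = Suc (length ys)" for x
  proof -
    have "x \<in> set (xs @ b # ys)" using that path_tab_eq_0_iff[of "xs @ b # ys" x] by auto
    then show ?thesis
      using bij_betw_imp_inj_on[OF bij_betw_path_tab[OF assms]] that v
      by (metis inj_onD in_set_conv_decomp)
  qed
  then show ?thesis unfolding pos_def using v by blast
qed

lemma rc_incr_path_tab:
  assumes "std_path L"
  shows "rc_incr (path_tab L) (set L)"
  using assms
proof (induction L)
  case Nil
  then show ?case by (simp add: rc_incr_def)
next
  case (Cons b L)
  have y: "young (set L)" and b: "b \<in> addable (set L)" and IH: "rc_incr (path_tab L) (set L)"
    using Cons std_path_young by auto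
  have "path_tab (b # L) (i, j) < path_tab (b # L) (i', j')"
    if *: "(i, j) \<in> set (b # L)" "(i', j') \<in> set (b # L)" "(i = i' \<and> j < j') \<or> (j = j' \<and> i < i')"
    for i j i' j'
  proof (cases "(i', j') = b")
    case True
    then have "(i, j) \<noteq> b" using * by auto
    then show ?thesis using True path_tab_le[of L "(i, j)"] by (simp add: less_Suc_eq_le)
  next
    case False
    then have i': "(i', j') \<in> set L" using * by auto
    have "(i, j) \<noteq> b"
    proof
      assume e: "(i, j) = b"
      have "1 \<le> i" "1 \<le> j" "(i, j) \<notin> set L" using b addable_iff[OF y, of i j] e by auto
      then show False using young_downward[OF y i', of i j] * by auto
    qed
    then have "path_tab L (i, j) < path_tab L (i', j')" using * by (intro rc_incrD[OF IH _ i']) auto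
    then show ?thesis using \<open>(i, j) \<noteq> b\<close> False by simp
  qed
  then show ?case by (rule rc_incrI)
qed

text \<open>The box of the largest entry is a corner, because entries increase to the right and
  downwards. Removing it leaves a standard tableau of size one less, so the path is built by
  recursion.\<close>

lemma tableau_path:
  assumes "young D" "shape W = D" "bij_betw W D {1..n}" "rc_incr W D"
  obtains L where "std_path L" "path_tab L = W" "length L = n"
proof -
  have "\<exists>L. std_path L \<and> path_tab L = W \<and> length L = n"
    using assms
  proof (induction n arbitrary: D W)
    case 0
    then have "D = {}" by (auto simp: bij_betw_def)
    then have "W = (\<lambda>_. 0)" using 0 by (auto simp: shape_def)
    then show ?case by (intro exI[of _ "[]"]) auto
  next
    case (Suc n)
    obtain b where b: "b \<in> D" "W b = Suc n" using Suc.prems(3) unfolding bij_betw_def by force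
    obtain i j where ij: "b = (i, j)" by force
    have le: "W x \<le> Suc n" if "x \<in> D" for x using Suc.prems(3) that by (auto simp: bij_betw_def)
    have "(i + 1, j) \<notin> D" "(i, j + 1) \<notin> D"
      using rc_incrD[OF Suc.prems(4), of i j "i + 1" j] rc_incrD[OF Suc.prems(4), of i j i "j + 1"]
        b le[of "(i + 1, j)"] le[of "(i, j + 1)"] unfolding ij by fastforce+
    then have c: "b \<in> corners D" using corners_iff[OF Suc.prems(1)] b ij by auto
    let ?W = "W(b := 0)"
    have "bij_betw W (D - {b}) ({1..Suc n} - {Suc n})"
      using bij_betw_DiffI[OF Suc.prems(3), of "{b}" "{Suc n}"] b by auto
    moreover have "{1..Suc n} - {Suc n} = {1..n}" by auto
    ultimately have "bij_betw W (D - {b}) {1..n}" by simp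
    then have bij: "bij_betw ?W (D - {b}) {1..n}" by (rule bij_betw_cong[THEN iffD1, rotated]) auto
    moreover have "shape ?W = D - {b}" using Suc.prems(2) by (auto simp: shape_def)
    moreover have "rc_incr ?W (D - {b})" 
    proof (rule rc_incrI)
      fix i j i' j'
      assume a: "(i, j) \<in> D - {b}" "(i', j') \<in> D - {b}" "(i = i' \<and> j < j') \<or> (j = j' \<and> i < i')"
      then have "W (i, j) < W (i', j')" by (intro rc_incrD[OF Suc.prems(4)]) auto
      then show "?W (i, j) < ?W (i', j')" using a by auto
    qed
    ultimately obtain L where L: "std_path L" "path_tab L = ?W" "length L = n"
      using Suc.IH[OF young_remove_corner[OF c]] by blast
    have "set L = D - {b}" using \<open>shape ?W = D - {b}\<close> L(2) shape_path_tab by metis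
    then have "std_path (b # L)" using L addable_remove_corner[OF Suc.prems(1) c] by simp
    moreover have "path_tab (b # L) = W" using L b by auto
    ultimately show ?case using L by (intro exI[of _ "b # L"]) auto
  qed
  then show thesis using that by blast
qed

lemma std_path_append: "std_path (xs @ ys) \<Longrightarrow> std_path ys"
  by (induction xs) auto

lemma std_path_swap_append:
  assumes "std_path (xs @ c # d # ys)" "fst c \<noteq> fst d" "snd c \<noteq> snd d"
  shows "std_path (xs @ d # c # ys)"
  using assms
proof (induction xs)
  case Nil
  then show ?case unfolding append_Nil by (rule std_path_swap)
qed (simp add: insert_commute)

lemma path_tab_swap_append:
  assumes "c \<noteq> d"
  shows "path_tab (xs @ d # c # ys) = swapv (Suc (length ys)) (Suc (length ys) + 1) (path_tab (xs @ c # d # ys))"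
proof (induction xs)
  case Nil
  have "path_tab ys x \<noteq> Suc (length ys)" "path_tab ys x \<noteq> Suc (Suc (length ys))" for x
    using path_tab_le[of ys x] by auto
  then show ?case using assms by (auto simp: swapv_def fun_eq_iff)
next
  case (Cons x xs)
  then show ?case by (auto simp: swapv_def fun_eq_iff)
qed

lemma split_two_at:
  assumes "Suc i < length L"
  obtains xs c d ys where "L = xs @ c # d # ys" "length xs = i"
proof -
  have "L = take i L @ L ! i # L ! Suc i # drop (Suc (Suc i)) L"
    using assms by (metis Cons_nth_drop_Suc Suc_lessD append_take_drop_id)
  then show thesis using that[of "take i L"] assms by simp
qed

section \<open>Linear operators and linear forms on formal combinations of triples\<close>

definition linear_op :: "op \<Rightarrow> bool" where
  "linear_op X \<longleftrightarrow> (\<forall>a b v w. X (\<lambda>\<sigma>. a * v \<sigma> + b * w \<sigma>) = (\<lambda>\<sigma>. a * X v \<sigma> + b * X w \<sigma>))"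

text \<open>Forms are the device for transposition: composing a coordinate evaluation with the
  operators still to be applied gives a number for each path, and the path functions above compute
  with these numbers.\<close>

definition linear_form :: "(vec \<Rightarrow> complex) \<Rightarrow> bool" where
  "linear_form \<phi> \<longleftrightarrow> (\<forall>a b v w. \<phi> (\<lambda>\<sigma>. a * v \<sigma> + b * w \<sigma>) = a * \<phi> v + b * \<phi> w)"

lemma linear_opD: "linear_op X \<Longrightarrow> X (\<lambda>\<sigma>. a * v \<sigma> + b * w \<sigma>) = (\<lambda>\<sigma>. a * X v \<sigma> + b * X w \<sigma>)"
  by (simp add: linear_op_def)

lemma linear_op_scale: "linear_op X \<Longrightarrow> X (\<lambda>\<sigma>. a * v \<sigma>) = (\<lambda>\<sigma>. a * X v \<sigma>)"
  using linear_opD[of X a v 0 v] by simp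

lemma linear_formD: "linear_form \<phi> \<Longrightarrow> \<phi> (\<lambda>\<sigma>. a * v \<sigma> + b * w \<sigma>) = a * \<phi> v + b * \<phi> w"
  by (simp add: linear_form_def)

lemma linear_form_sum:
  assumes "linear_form \<phi>" "finite A"
  shows "\<phi> (\<lambda>\<sigma>. \<Sum>x\<in>A. a x * v x \<sigma>) = (\<Sum>x\<in>A. a x * \<phi> (v x))"
  using assms(2)
proof (induction A)
  case empty
  show ?case using linear_formD[OF assms(1), of 0 "\<lambda>_. 0" 0 "\<lambda>_. 0"] by simp
next
  case (insert x A)
  then show ?case
    using linear_formD[OF assms(1), of "a x" "v x" 1 "\<lambda>\<sigma>. \<Sum>x\<in>A. a x * v x \<sigma>"] by simp
qed

lemma linear_form_comp: "linear_form \<phi> \<Longrightarrow> linear_op X \<Longrightarrow> linear_form (\<lambda>v. \<phi> (X v))"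
  by (simp add: linear_form_def linear_op_def)

lemma linear_form_eval: "linear_form (\<lambda>v. v \<sigma>)"
  by (simp add: linear_form_def)

lemma linear_op_comp: "linear_op X \<Longrightarrow> linear_op Y \<Longrightarrow> linear_op (\<lambda>v. X (Y v))"
  by (simp add: linear_op_def)

lemma linear_op_lin: "linear_op (lin T X)"
  by (simp add: linear_op_def lin_def sum_distrib_left sum.distrib distrib_right mult.assoc)

lemma lin_delta:
  assumes "finite T" "\<tau> \<in> T"
  shows "lin T X (delta \<tau>) = X \<tau>"
proof
  fix \<sigma>
  have "(\<Sum>t\<in>T. delta \<tau> t * X t \<sigma>) = (\<Sum>t\<in>T. if t = \<tau> then X t \<sigma> else 0)"
    by (rule sum.cong) (auto simp: delta_def)
  then show "lin T X (delta \<tau>) \<sigma> = X \<tau> \<sigma>" using assms by (simp add: lin_def)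
qed

lemma linear_op_hinv: "linear_op (hinv_op P m n lam' lam i)"
proof -
  have "linear_op (h_op P m n lam' lam i)" by (simp add: h_op_def linear_op_lin)
  then show ?thesis
    unfolding linear_op_def hinv_op_def
    by (auto simp: fun_eq_iff add_divide_distrib diff_divide_distrib algebra_simps)
qed

lemma linear_op_Lh: "linear_op (Lh P m n lam' lam k)"
proof (induction k)
  case (Suc k)
  then show ?case using linear_op_comp[OF linear_op_hinv Suc] by (simp add: comp_def)
qed (simp add: linear_op_def)

lemma linear_op_Rh: "linear_op (Rh P m n lam' lam k)"
proof (induction k)
  case (Suc k)
  then show ?case using linear_op_comp[OF Suc linear_op_hinv] by (simp add: comp_def)
qed (simp add: linear_op_def)

lemma linear_op_J_np1: "linear_op (J_np1 P m n lam' lam)"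
proof -
  have "linear_op (E_op P m n lam' lam)" by (simp add: E_op_def linear_op_lin)
  then have "linear_op (\<lambda>v. Lh P m n lam' lam k (E_op P m n lam' lam (Rh P m n lam' lam k v)))" for k
    by (rule linear_op_comp[OF linear_op_Lh linear_op_comp[OF _ linear_op_Rh]])
  from linear_opD[OF this] show ?thesis
    unfolding linear_op_def J_np1_def
    by (simp add: fun_eq_iff sum_distrib_left sum.distrib algebra_simps)
qed

lemma linear_op_conj:
  assumes "linear_op H" "linear_op J"
  shows "linear_op (\<lambda>v \<sigma>. H (J (H v)) \<sigma> / c)"
proof -
  have "linear_op (\<lambda>v. H (J (H v)))"
    by (rule linear_op_comp[OF assms(1) linear_op_comp[OF assms(2,1)]])
  then show ?thesis by (auto simp: linear_op_def fun_eq_iff add_divide_distrib)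
qed

lemma linear_op_JM: "linear_op (JM P m n lam' lam k)"
proof (induction k)
  case 0
  show ?case by (simp add: linear_op_def)
next
  case (Suc k)
  have "linear_op id" by (simp add: linear_op_def)
  moreover have "linear_op (h_op P m n lam' lam i)" "linear_op (g_op P m n lam' lam i)" for i
    by (simp_all add: h_op_def g_op_def linear_op_lin)
  ultimately show ?case
    unfolding JM.simps using Suc.IH linear_op_J_np1 linear_op_conj by presburger
qed

section \<open>Finiteness of the set of standard triples\<close>

lemma young_subset_square:
  assumes "young D"
  shows "D \<subseteq> {1..card D} \<times> {1..card D}"
proof
  fix b assume b: "b \<in> D"
  obtain i j where ij: "b = (i, j)" by force
  have f: "finite D" using young_finite[OF assms] .
  have "{1..i} \<times> {j} \<subseteq> D" using young_downward[OF assms, of i j] b ij young_ge_1[OF assms, of i j] by auto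
  from card_mono[OF f this] have "i \<le> card D" by simp
  moreover have "{i} \<times> {1..j} \<subseteq> D" using young_downward[OF assms, of i j] b ij young_ge_1[OF assms, of i j] by auto
  from card_mono[OF f this] have "j \<le> card D" by simp
  ultimately show "b \<in> {1..card D} \<times> {1..card D}" using young_ge_1[OF assms, of i j] b ij by auto
qed

text \<open>Needed because \<open>lin\<close> sums over \<open>Tset\<close>, and a sum over an
  infinite set has the default value 0. All entries are bounded, and the shape of \<open>W\<close>
  fits into an n by n square.\<close>

lemma finite_Tset: "finite (Tset m n lam' lam)"
proof -
  let ?Q = "{1..n} \<times> {1..n}"
  let ?TB = "{f :: tab. \<forall>x. (x \<in> lam' \<longrightarrow> f x \<in> {0..m}) \<and> (x \<notin> lam' \<longrightarrow> f x = 0)}"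
  let ?TS = "{f :: tab. \<forall>x. (x \<in> ?Q \<longrightarrow> f x \<in> {0..m}) \<and> (x \<notin> ?Q \<longrightarrow> f x = 0)}"
  let ?TW = "{f :: tab. \<forall>x. (x \<in> ?Q \<longrightarrow> f x \<in> {0..n}) \<and> (x \<notin> ?Q \<longrightarrow> f x = 0)}"
  have "Tset m n lam' lam \<subseteq> ?TB \<times> ?TS \<times> ?TW"
  proof
    fix \<tau> assume "\<tau> \<in> Tset m n lam' lam"
    then obtain B S W where t: "\<tau> = (B, S, W)" and st: "std_triple m n lam' lam (B, S, W)"
      by (cases \<tau>) (auto simp: Tset_def)
    have bij: "bij_betw W (shape W) {1..n}" and y: "young (shape W)" and sB: "shape B = lam'"
      and sS: "shape S = shape W - lam" and v: "vals B \<union> vals S = {1..m}"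
      using st by (auto simp: std_triple_def)
    have "card (shape W) = n" using bij_betw_same_card[OF bij] by simp
    then have sq: "shape W \<subseteq> ?Q" using young_subset_square[OF y] by simp
    have "B x \<le> m" for x using v by (cases "B x = 0") (auto simp: vals_def shape_def)
    moreover have "S x \<le> m" for x using v by (cases "S x = 0") (auto simp: vals_def shape_def)
    moreover have "W x \<le> n" for x using bij by (cases "W x = 0") (auto simp: bij_betw_def shape_def)
    moreover have "B x = 0" if "x \<notin> lam'" for x using sB that by (auto simp: shape_def)
    moreover have "W x = 0" "S x = 0" if "x \<notin> ?Q" for x
    proof -
      have "x \<notin> shape W" "x \<notin> shape S" using sq sS that by auto
      then show "W x = 0" "S x = 0" by (simp_all add: shape_def)
    qed
    ultimately show "\<tau> \<in> ?TB \<times> ?TS \<times> ?TW" by (simp add: t)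
  qed
  moreover have "finite (?TB \<times> ?TS \<times> ?TW)" if "finite lam'"
    using that by (intro finite_cartesian_product finite_set_of_finite_funs) auto
  moreover have "finite lam'" if ne: "Tset m n lam' lam \<noteq> {}"
  proof -
    obtain B S W where st: "std_triple m n lam' lam (B, S, W)" using ne by (auto simp: Tset_def)
    then have "inj_on B lam'" "B ` lam' \<subseteq> {1..m}" by (auto simp: std_triple_def vals_def)
    then show ?thesis using finite_imageD finite_subset by blast
  qed
  ultimately show ?thesis
    by (cases "Tset m n lam' lam = {}") (simp, blast intro: finite_subset)
qed

text \<open>The box added last is addable to a diagram of which the previous box is a corner. Hence
  aligned consecutive boxes are adjacent, with contents differing by one.\<close>

lemma std_path_consecutive:
  assumes "std_path (xs @ c # d # ys)"
  shows "HD d \<noteq> HD c" "fst c = fst d \<Longrightarrow> HD d - HD c = 1" "snd c = snd d \<Longrightarrow> HD d - HD c = - 1"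
proof -
  have s: "std_path (c # d # ys)" using std_path_append[OF assms] .
  have y: "young (set (d # ys))" using s std_path_young[of "d # ys"] by simp
  have d: "d \<in> corners (set (d # ys))" using s std_path_hd_corner[of d ys] by simp
  have c: "c \<in> addable (set (d # ys))" using s by simp
  show "HD d \<noteq> HD c" using HD_corner_neq_addable[OF y c d] .
  show "fst c = fst d \<Longrightarrow> HD d - HD c = 1"
    using addable_same_row_corner[OF y c d] by (simp add: HD_def)
  show "snd c = snd d \<Longrightarrow> HD d - HD c = - 1"
    using addable_same_col_corner[OF y c d] by (simp add: HD_def)
qed

lemma std_tripleD:
  assumes "std_triple m n lam' lam (B, S, W)"
  shows "young (shape W)" "lam \<subseteq> shape W" "card (shape W - lam) = m - card lam'"
    "bij_betw W (shape W) {1..n}" "rc_incr W (shape W)" "shape B = lam'" "inj_on B (shape B)" "rc_incr B (shape B)"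
    "shape S = shape W - lam" "inj_on S (shape S)" "rc_decr S (shape S)"
    "vals B \<inter> vals S = {}" "vals B \<union> vals S = {1..m}"
  using assms unfolding std_triple_def prod.case by (elim conjE, simp only:)+

lemma std_triple_path:
  assumes "std_triple m n lam' lam (B, S, W)"
  obtains L where "std_path L" "path_tab L = W" "length L = n"
  using tableau_path[OF std_tripleD(1)[OF assms] refl std_tripleD(4,5)[OF assms]] that by blast

text \<open>The conditions on \<open>B\<close> and \<open>S\<close> see \<open>W\<close> only
  through its shape, and every standard path on that shape yields a standard filling.\<close>

lemma std_triple_change_path:
  assumes "std_triple m n lam' lam (B, S, path_tab L)" "std_path L" "std_path L'" "set L' = set L"
  shows "std_triple m n lam' lam (B, S, path_tab L')"
proof -
  have "length L' = length L" using assms(2-4) std_path_distinct distinct_card by metis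
  moreover have "length L = n"
    using bij_betw_same_card[OF std_tripleD(4)[OF assms(1)]] distinct_card[OF std_path_distinct[OF assms(2)]]
    by (simp add: shape_path_tab)
  ultimately have "bij_betw (path_tab L') (set L') {1..n}"
    using bij_betw_path_tab[OF std_path_distinct[OF assms(3)]] by simp
  then show ?thesis
    using assms(1,4) rc_incr_path_tab[OF assms(3)] unfolding std_triple_def prod.case shape_path_tab by auto
qed

section \<open>Exchanging two consecutive labels of \<open>B\<close> and \<open>S\<close>\<close>

definition sw :: "nat \<Rightarrow> nat \<Rightarrow> nat" where
  "sw j x = (if x = j then j + 1 else if x = j + 1 then j else x)"

lemma sw_sw [simp]: "sw j (sw j x) = x"
  by (auto simp: sw_def)

lemma sw_simps [simp]: "sw j j = j + 1" "sw j (j + 1) = j" "sw j (Suc j) = j"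
  by (auto simp: sw_def)

lemma sw_eq_iff: "sw j x = y \<longleftrightarrow> x = sw j y"
  by (metis sw_sw)

lemma sw_inject [simp]: "sw j x = sw j y \<longleftrightarrow> x = y"
  by (metis sw_sw)

lemma swapv_eq: "swapv j (j + 1) T = (\<lambda>x. sw j (T x))"
  by (auto simp: swapv_def sw_def)

lemma swapv_swapv: "swapv j (j + 1) (swapv j (j + 1) T) = T"
  unfolding swapv_eq by simp

lemma shape_swapv: "1 \<le> j \<Longrightarrow> shape (swapv j (j + 1) T) = shape T"
  unfolding shape_def swapv_eq by (auto simp: sw_def)

lemma vals_swapv: "1 \<le> j \<Longrightarrow> vals (swapv j (j + 1) T) = sw j ` vals T"
  by (simp only: vals_def shape_swapv) (simp only: swapv_eq image_image)

lemma in_vals_swapv: "1 \<le> j \<Longrightarrow> a \<in> vals (swapv j (j + 1) T) \<longleftrightarrow> sw j a \<in> vals T"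
  unfolding vals_swapv by (metis imageE image_eqI sw_sw)

lemma pos_swapv: "pos (swapv j (j + 1) T) a = pos T (sw j a)"
  unfolding pos_def swapv_eq sw_eq_iff ..

lemma pos_eq:
  assumes "inj_on T (shape T)" "T b = a" "a \<noteq> 0"
  shows "pos T a = b"
  unfolding pos_def
proof (rule the_equality)
  fix x assume "T x = a"
  then have "x \<in> shape T" "b \<in> shape T" "T x = T b" using assms by (auto simp: shape_def)
  then show "x = b" using assms(1) by (simp add: inj_on_def)
qed (rule assms(2))

lemma pos_vals:
  assumes "inj_on T (shape T)" "a \<in> vals T"
  shows "T (pos T a) = a" "pos T a \<in> shape T"
proof -
  obtain b where b: "b \<in> shape T" "T b = a" using assms(2) by (auto simp: vals_def)
  then have "pos T a = b" using assms(1) by (intro pos_eq) (auto simp: shape_def)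
  then show "T (pos T a) = a" "pos T a \<in> shape T" using b by auto
qed

text \<open>Order-convexity is what the straight shape of \<open>B\<close> and the skew shape of
  \<open>S\<close> have in common; it lets one argument treat both.\<close>

definition convex_boxes :: "box set \<Rightarrow> bool" where
  "convex_boxes D \<longleftrightarrow> (\<forall>i j i' j' a b. (i, j) \<in> D \<longrightarrow> (i', j') \<in> D \<longrightarrow> i \<le> a \<longrightarrow> a \<le> i'
     \<longrightarrow> j \<le> b \<longrightarrow> b \<le> j' \<longrightarrow> (a, b) \<in> D)"

lemma convex_boxesD:
  "convex_boxes D \<Longrightarrow> (i, j) \<in> D \<Longrightarrow> (i', j') \<in> D \<Longrightarrow> i \<le> a \<Longrightarrow> a \<le> i' \<Longrightarrow> j \<le> b \<Longrightarrow> b \<le> j' \<Longrightarrow> (a, b) \<in> D"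
  unfolding convex_boxes_def by blast

lemma convex_boxes_skew:
  assumes "young D" "young E"
  shows "convex_boxes (D - E)"
  unfolding convex_boxes_def
proof (intro allI impI)
  fix i j i' j' a b assume a: "(i, j) \<in> D - E" "(i', j') \<in> D - E" "i \<le> a" "a \<le> i'" "j \<le> b" "b \<le> j'"
  have ge: "1 \<le> i" "1 \<le> j" using young_ge_1[OF assms(1)] a by auto
  have "(a, b) \<in> D" using young_downward[OF assms(1), of i' j' a b] a ge by auto
  moreover have "(a, b) \<notin> E" using young_downward[OF assms(2), of a b i j] a ge by auto
  ultimately show "(a, b) \<in> D - E" by simp
qed

lemma convex_boxes_young: "young D \<Longrightarrow> convex_boxes D"
  using convex_boxes_skew[of D "{}"] by (simp add: young_def[of "{}"])

text \<open>If the two boxes were in one row or column without being adjacent, or on one diagonal,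
  convexity would supply a box between them, and its entry would have to lie strictly between two
  consecutive numbers.\<close>

lemma consecutive_incr:
  assumes D: "convex_boxes D" and T: "rc_incr T D" and p: "p \<in> D" "p' \<in> D" "T p' = T p + 1"
  shows "fst p = fst p' \<Longrightarrow> HD p' = HD p - 1" "snd p = snd p' \<Longrightarrow> HD p' = HD p + 1" "HD p \<noteq> HD p'"
proof -
  obtain i j i' j' where ij: "p = (i, j)" "p' = (i', j')" by (metis surj_pair)
  note p = p[unfolded ij]
  note lt = rc_incrD[OF T]
  { assume "fst p = fst p'"
    then have e: "i' = i" by (simp add: ij)
    have "\<not> j' < j" using lt[OF p(2,1)] p(3) e by auto
    moreover have "j' \<noteq> j" using p(3) e by auto
    moreover have "\<not> j + 1 < j'"
    proof
      assume l: "j + 1 < j'"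
      have m: "(i, j + 1) \<in> D" using convex_boxesD[OF D p(1,2), of i "j + 1"] l e by auto
      show False using lt[OF p(1) m] lt[OF m p(2)] p(3) l e by auto
    qed
    ultimately show "HD p' = HD p - 1" using e by (auto simp: ij HD_def) }
  { assume "snd p = snd p'"
    then have e: "j' = j" by (simp add: ij)
    have "\<not> i' < i" using lt[OF p(2,1)] p(3) e by auto
    moreover have "i' \<noteq> i" using p(3) e by auto
    moreover have "\<not> i + 1 < i'"
    proof
      assume l: "i + 1 < i'"
      have m: "(i + 1, j) \<in> D" using convex_boxesD[OF D p(1,2), of "i + 1" j] l e by auto
      show False using lt[OF p(1) m] lt[OF m p(2)] p(3) l e by auto
    qed
    ultimately show "HD p' = HD p + 1" using e by (auto simp: ij HD_def) }
  show "HD p \<noteq> HD p'"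
  proof
    assume "HD p = HD p'"
    then have "HD (i, j) = HD (i', j')" by (simp add: ij)
    then show False
    proof (cases rule: HD_eq_cases)
      case 1
      then show ?thesis using p by simp
    next
      case (2 e)
      have m: "(i, j') \<in> D" using convex_boxesD[OF D p(1,2), of i j'] 2 by auto
      show ?thesis using lt[OF p(1) m] lt[OF m p(2)] p(3) 2 by auto
    next
      case (3 e)
      have m: "(i', j) \<in> D" using convex_boxesD[OF D p(2,1), of i' j] 3 by auto
      show ?thesis using lt[OF p(2) m] lt[OF m p(1)] p(3) 3 by auto
    qed
  qed
qed

lemma consecutive_decr:
  assumes D: "convex_boxes D" and T: "rc_decr T D" and p: "p \<in> D" "p' \<in> D" "T p' = T p + 1"
    and bd: "\<And>x. x \<in> D \<Longrightarrow> T x \<le> m"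
  shows "fst p = fst p' \<Longrightarrow> HD p' = HD p + 1" "snd p = snd p' \<Longrightarrow> HD p' = HD p - 1" "HD p \<noteq> HD p'"
proof -
  \<comment> \<open>Complementing the entries makes the filling increasing and interchanges
    \<open>p\<close> and \<open>p'\<close>. The bound \<open>bd\<close> ensures that the subtraction
    of natural numbers is not truncated.\<close>
  have T': "rc_incr (\<lambda>x. m - T x) D"
  proof (rule rc_incrI)
    fix i j i' j'
    assume a: "(i, j) \<in> D" "(i', j') \<in> D" "(i = i' \<and> j < j') \<or> (j = j' \<and> i < i')"
    show "m - T (i, j) < m - T (i', j')" using rc_decrD[OF T a] bd[OF a(1)] bd[OF a(2)] by linarith
  qed
  have "m - T p = m - T p' + 1" using p(3) bd[OF p(2)] by linarith
  note * = consecutive_incr[OF D T' p(2,1) this]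
  show "fst p = fst p' \<Longrightarrow> HD p' = HD p + 1" "snd p = snd p' \<Longrightarrow> HD p' = HD p - 1" "HD p \<noteq> HD p'"
    using * by auto
qed

lemma sw_less:
  assumes "x < y" "\<not> (x = j \<and> y = j + 1)"
  shows "sw j x < sw j y"
  using assms by (auto simp: sw_def)

text \<open>Both labels are required to occur because \<open>pos\<close> is a definite description,
  which says nothing about a label that is absent.\<close>

definition same_row :: "nat \<Rightarrow> tab \<Rightarrow> bool" where
  "same_row j T \<longleftrightarrow> j \<in> vals T \<and> j + 1 \<in> vals T \<and> fst (pos T j) = fst (pos T (j + 1))"

definition same_col :: "nat \<Rightarrow> tab \<Rightarrow> bool" where
  "same_col j T \<longleftrightarrow> j \<in> vals T \<and> j + 1 \<in> vals T \<and> snd (pos T j) = snd (pos T (j + 1))"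

lemma same_row_swapv: "1 \<le> j \<Longrightarrow> same_row j (swapv j (j + 1) T) \<longleftrightarrow> same_row j T"
  unfolding same_row_def in_vals_swapv pos_swapv by auto

lemma same_col_swapv: "1 \<le> j \<Longrightarrow> same_col j (swapv j (j + 1) T) \<longleftrightarrow> same_col j T"
  unfolding same_col_def in_vals_swapv pos_swapv by auto

lemma not_same_line:
  assumes "inj_on T (shape T)" "\<not> same_row j T" "\<not> same_col j T" "1 \<le> j"
    and "T (i, k) = j" "T (i', k') = j + 1" "i = i' \<or> k = k'"
  shows False
proof -
  have "(i, k) \<in> shape T" "(i', k') \<in> shape T" using assms(4-6) by (auto simp: shape_def)
  then have "j \<in> vals T" "j + 1 \<in> vals T" using assms(5,6) by (auto simp: vals_def intro: rev_image_eqI)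
  moreover have "pos T j = (i, k)" "pos T (j + 1) = (i', k')"
    using assms(1,4-6) by (auto intro!: pos_eq)
  ultimately show False using assms(2,3,7) by (auto simp: same_row_def same_col_def)
qed

lemma rc_incr_swapv:
  assumes "rc_incr T (shape T)" "inj_on T (shape T)" "\<not> same_row j T" "\<not> same_col j T" "1 \<le> j"
  shows "rc_incr (swapv j (j + 1) T) (shape T)"
proof (rule rc_incrI)
  fix i k i' k' assume a: "(i, k) \<in> shape T" "(i', k') \<in> shape T" "(i = i' \<and> k < k') \<or> (k = k' \<and> i < i')"
  have "\<not> (T (i, k) = j \<and> T (i', k') = j + 1)"
    using not_same_line[OF assms(2-5)] a(3) by blast
  then show "swapv j (j + 1) T (i, k) < swapv j (j + 1) T (i', k')"
    unfolding swapv_eq by (intro sw_less rc_incrD[OF assms(1) a])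
qed

lemma rc_decr_swapv:
  assumes "rc_decr T (shape T)" "inj_on T (shape T)" "\<not> same_row j T" "\<not> same_col j T" "1 \<le> j"
  shows "rc_decr (swapv j (j + 1) T) (shape T)"
proof (rule rc_decrI)
  fix i k i' k' assume a: "(i, k) \<in> shape T" "(i', k') \<in> shape T" "(i = i' \<and> k < k') \<or> (k = k' \<and> i < i')"
  have "\<not> (T (i', k') = j \<and> T (i, k) = j + 1)"
    using not_same_line[OF assms(2-5)] a(3) by blast
  then show "swapv j (j + 1) T (i', k') < swapv j (j + 1) T (i, k)"
    unfolding swapv_eq by (intro sw_less rc_decrD[OF assms(1) a])
qed

text \<open>The exchange changes no order relation except that between \<open>j\<close> and
  \<open>j + 1\<close> themselves, and this one is tested only when both lie in one line of the same
  filling.\<close>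

lemma std_triple_swapv:
  assumes st: "std_triple m n lam' lam (B, S, W)" and j: "1 \<le> j" "j + 1 \<le> m"
    and "\<not> same_row j B" "\<not> same_col j B" "\<not> same_row j S" "\<not> same_col j S"
  shows "std_triple m n lam' lam (swapv j (j + 1) B, swapv j (j + 1) S, W)"
proof -
  have B: "shape B = lam'" "inj_on B lam'" "rc_incr B lam'" and S: "inj_on S (shape S)" "rc_decr S (shape S)"
    and v: "vals B \<inter> vals S = {}" "vals B \<union> vals S = {1..m}" using st by (auto simp: std_triple_def)
  have inj: "inj_on (swapv j (j + 1) T) (shape T)" if "inj_on T (shape T)" for T
    using that unfolding swapv_eq inj_on_def by simp
  have "sw j ` vals B \<inter> sw j ` vals S = {}" using v(1) by auto
  moreover have "sw j ` vals B \<union> sw j ` vals S = {1..m}"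
  proof -
    have "sw j ` {1..m} \<subseteq> {1..m}" using j by (auto simp: sw_def)
    moreover have "{1..m} \<subseteq> sw j ` {1..m}"
    proof
      fix x assume "x \<in> {1..m}"
      then have "sw j x \<in> {1..m}" using j by (auto simp: sw_def)
      then show "x \<in> sw j ` {1..m}" by (metis image_eqI sw_sw)
    qed
    ultimately show ?thesis unfolding image_Un[symmetric] v(2) by blast
  qed
  moreover have "rc_incr (swapv j (j + 1) B) lam'" using rc_incr_swapv[of B j] B assms by simp
  moreover have "rc_decr (swapv j (j + 1) S) (shape S)" using rc_decr_swapv[of S j] S assms by simp
  ultimately show ?thesis
    using st inj[of B] inj[of S] B S
    unfolding std_triple_def prod.case shape_swapv[OF j(1)] vals_swapv[OF j(1)] by auto
qed

section \<open>Diagonal action of the Jucys--Murphy elements\<close>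

context qwb
begin

section \<open>The generators h and the indices up to n\<close>

definition aco :: "box \<Rightarrow> box \<Rightarrow> complex" where
  "aco c d = (\<alpha> + \<beta>) / (1 - q powi (HD d - HD c))"

definition oco :: "box \<Rightarrow> box \<Rightarrow> complex" where
  "oco c d = (if fst c = fst d \<or> snd c = snd d then 0 else eta P (q powi (HD d - HD c)))"

text \<open>From \<beta> = - q \<alpha> one gets
  \<open>(\<alpha> + \<beta>) / (1 - q) = \<alpha>\<close> and, in \<open>aco_col\<close>,
  \<open>(\<alpha> + \<beta>) / (1 - 1 / q) = \<beta>\<close>. The generic diagonal entry thus
  covers aligned boxes.\<close>

lemma aco_row: "HD d - HD c = 1 \<Longrightarrow> aco c d = \<alpha>"
  unfolding aco_def beta_eq using nz(1) by (simp add: divide_simps) (simp add: algebra_simps)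

lemma aco_col: "HD d - HD c = - 1 \<Longrightarrow> aco c d = \<beta>"
  unfolding aco_def beta_eq using nz(1)
  by (simp add: divide_simps power_int_minus) (simp add: algebra_simps)

lemma Wt_path:
  assumes "distinct (xs @ b # ys)" "n = length (xs @ b # ys)"
  shows "Wt P n (B, S, path_tab (xs @ b # ys)) (length ys) = q powi HD b"
  using pos_path_tab[OF assms(1)] assms(2) by (simp add: Wt_def)

text \<open>Aligned consecutive boxes are adjacent, so the three cases of \<open>h_basis\<close>
  merge into one formula. Paths begin with the entry \<open>n\<close>, hence the generator index is
  one more than the number of boxes in front of \<open>c\<close>.\<close>

lemma h_basis_path:
  assumes std: "std_path (xs @ c # d # ys)" and n: "n = length (xs @ c # d # ys)"
  shows "h_basis P n (Suc (length xs)) (B, S, path_tab (xs @ c # d # ys)) =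
    (\<lambda>\<sigma>. aco c d * delta (B, S, path_tab (xs @ c # d # ys)) \<sigma>
        + oco c d * delta (B, S, path_tab (xs @ d # c # ys)) \<sigma>)"
proof -
  have dist: "distinct (xs @ c # d # ys)" "distinct ((xs @ [c]) @ d # ys)"
    using std_path_distinct[OF std] by auto
  have k: "n - Suc (length xs) = Suc (length ys)" using n by simp
  have pd: "pos (path_tab (xs @ c # d # ys)) (Suc (length ys)) = d"
    using pos_path_tab[OF dist(2)] by simp
  have pc: "pos (path_tab (xs @ c # d # ys)) (Suc (length ys) + 1) = c"
    using pos_path_tab[OF dist(1)] by simp
  have wd: "Wt P n (B, S, path_tab (xs @ c # d # ys)) (Suc (length ys) - 1) = q powi HD d"
    using Wt_path[OF dist(2), of n B S] n by simp
  have wc: "Wt P n (B, S, path_tab (xs @ c # d # ys)) (Suc (length ys)) = q powi HD c"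
    using Wt_path[OF dist(1), of n B S] n by simp
  have cd: "c \<noteq> d" using dist by auto
  have x: "q powi HD d / q powi HD c = q powi (HD d - HD c)" by (simp add: power_int_diff)
  have "h_basis P n (Suc (length xs)) (B, S, path_tab (xs @ c # d # ys)) =
    (if fst d = fst c then (\<lambda>\<sigma>. \<alpha> * delta (B, S, path_tab (xs @ c # d # ys)) \<sigma>)
     else if snd d = snd c then (\<lambda>\<sigma>. \<beta> * delta (B, S, path_tab (xs @ c # d # ys)) \<sigma>)
     else (\<lambda>\<sigma>. aco c d * delta (B, S, path_tab (xs @ c # d # ys)) \<sigma>
        + eta P (q powi (HD d - HD c)) * delta (B, S, path_tab (xs @ d # c # ys)) \<sigma>))"
    unfolding h_basis_def prod.case Let_def k pd pc wd wc x path_tab_swap_append[OF cd, symmetric] aco_def ..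
  moreover have "aco c d = \<alpha>" if "fst d = fst c"
    using aco_row std_path_consecutive(2)[OF std] that by simp
  moreover have "aco c d = \<beta>" if "snd d = snd c"
    using aco_col std_path_consecutive(3)[OF std] that by simp
  ultimately show ?thesis by (simp add: oco_def)
qed

lemma hinv_fun_append:
  "hinv_fun (length xs) F (xs @ c # d # ys) = tco c d * F (xs @ c # d # ys) + sco c d * F (xs @ d # c # ys)"
  by (induction xs arbitrary: F) auto

lemma tco_aco: "tco c d = ((\<alpha> + \<beta>) - aco c d) / (\<alpha> * \<beta>)"
  by (simp add: tco_def aco_def)

lemma sco_oco: "sco c d = - oco c d / (\<alpha> * \<beta>)"
  by (simp add: sco_def oco_def)

lemma conj_scalar:
  fixes H J :: op
  assumes "linear_op H" "linear_op J" "H t = (\<lambda>\<sigma>. a * t \<sigma>)" "J t = (\<lambda>\<sigma>. \<mu> * t \<sigma>)"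
    and "a * a * \<mu> = - (\<alpha> * \<beta>) * \<nu>"
  shows "(\<lambda>\<sigma>. H (J (H t)) \<sigma> / - (\<alpha> * \<beta>)) = (\<lambda>\<sigma>. \<nu> * t \<sigma>)"
proof
  fix \<sigma>
  have "H (J (H t)) \<sigma> = (a * a * \<mu>) * t \<sigma>"
    by (simp add: assms(3,4) linear_op_scale[OF assms(1)] linear_op_scale[OF assms(2)] mult_ac)
  then show "H (J (H t)) \<sigma> / - (\<alpha> * \<beta>) = \<nu> * t \<sigma>" unfolding assms(5) by (simp add: field_simps)
qed

text \<open>A computation in the span of \<open>t\<close> and \<open>t'\<close>, where
  \<open>J\<close> is diagonal with eigenvalues \<mu> and \<nu>. It serves both \<eta> and \<zeta>,
  as only the product of the two off-diagonal entries enters.\<close>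

lemma conj_swap:
  fixes H J :: op
  assumes lin: "linear_op H" "linear_op J"
    and H: "H t = (\<lambda>\<sigma>. (\<alpha> + \<beta>) / (1 - \<mu> / \<nu>) * t \<sigma> + e * t' \<sigma>)"
      "H t' = (\<lambda>\<sigma>. (\<alpha> + \<beta>) / (1 - \<nu> / \<mu>) * t' \<sigma> + e' * t \<sigma>)"
    and J: "J t = (\<lambda>\<sigma>. \<mu> * t \<sigma>)" "J t' = (\<lambda>\<sigma>. \<nu> * t' \<sigma>)"
    and ne: "\<mu> \<noteq> 0" "\<nu> \<noteq> 0" "\<mu> \<noteq> \<nu>" and e: "e * e' = - \<alpha> * \<beta> * Ffun P (\<mu> / \<nu>)"
  shows "(\<lambda>\<sigma>. H (J (H t)) \<sigma> / - (\<alpha> * \<beta>)) = (\<lambda>\<sigma>. \<nu> * t \<sigma>)"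
proof
  fix \<sigma>
  let ?a = "(\<alpha> + \<beta>) / (1 - \<mu> / \<nu>)" and ?a' = "(\<alpha> + \<beta>) / (1 - \<nu> / \<mu>)"
  have JH: "J (H t) = (\<lambda>\<sigma>. ?a * \<mu> * t \<sigma> + e * \<nu> * t' \<sigma>)"
    unfolding H(1) linear_opD[OF lin(2)] J by (simp add: mult_ac)
  have "H (J (H t)) \<sigma> = ?a * \<mu> * (?a * t \<sigma> + e * t' \<sigma>) + e * \<nu> * (?a' * t' \<sigma> + e' * t \<sigma>)"
    unfolding JH by (simp only: linear_opD[OF lin(1)] H)
  also have "\<dots> = (?a * ?a * \<mu> + (e * e') * \<nu>) * t \<sigma> + e * (?a * \<mu> + ?a' * \<nu>) * t' \<sigma>"
    by (simp add: algebra_simps)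
  \<comment> \<open>The two terms are
    \<open>(\<alpha> + \<beta>) * \<mu> * \<nu> / (\<nu> - \<mu>)\<close> with opposite signs, so
    the component along \<open>t'\<close> cancels.\<close>
  also have "?a * \<mu> + ?a' * \<nu> = 0"
    using ne by (simp add: divide_simps) algebra
  \<comment> \<open>After clearing denominators this is \<open>(1 - q)\<^sup>2 * \<mu> * \<nu> +
    (\<nu> - q * \<mu>) * (q * \<nu> - \<mu>) = q * (\<nu> - \<mu>)\<^sup>2\<close>.\<close>
  also have "?a * ?a * \<mu> + (e * e') * \<nu> = - (\<alpha> * \<beta>) * \<nu>"
  proof -
    have d: "\<nu> - \<mu> \<noteq> 0" using ne by simp
    have a: "?a = \<alpha> * (1 - q) * \<nu> / (\<nu> - \<mu>)" unfolding beta_eq using ne d by (simp add: field_simps)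
    have f: "Ffun P (\<mu> / \<nu>) = (\<nu> - q * \<mu>) * (q * \<nu> - \<mu>) / (q * (\<nu> - \<mu>)\<^sup>2)"
      unfolding Ffun_eq using ne d q_nz by (simp add: divide_simps) algebra
    show ?thesis unfolding a e f beta_eq using ne d q_nz nz(1) by (simp add: divide_simps power2_eq_square) algebra
  qed
  finally show "H (J (H t)) \<sigma> / - (\<alpha> * \<beta>) = \<nu> * t \<sigma>" by (simp add: field_simps)
qed

lemma eta_mult:
  assumes "x \<noteq> 0" "x \<noteq> 1"
  shows "eta P x * eta P (1 / x) = - \<alpha> * \<beta> * Ffun P x" "zeta P x * zeta P (1 / x) = - \<alpha> * \<beta> * Ffun P x"
  using ez assms unfolding eta_zeta_ok_def by blast+

text \<open>The conjugating generator involves the entries \<open>k\<close> and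
  \<open>k + 1\<close>, whose weights have indices \<open>k - 1\<close> and \<open>k\<close>.
  Aligned entries give a scalar; otherwise the exchanged triple is standard too, and
  \<open>IH\<close> supplies both eigenvalues that \<open>conj_swap\<close> needs.\<close>

lemma JM_h_step:
  assumes k: "1 \<le> k" "Suc k \<le> n"
    and IH: "\<And>\<tau>. std_triple m n lam' lam \<tau> \<Longrightarrow> JM P m n lam' lam k (delta \<tau>) = (\<lambda>\<sigma>. Wt P n \<tau> (k - 1) * delta \<tau> \<sigma>)"
    and st: "std_triple m n lam' lam \<tau>"
  shows "JM P m n lam' lam (Suc k) (delta \<tau>) = (\<lambda>\<sigma>. Wt P n \<tau> k * delta \<tau> \<sigma>)"
proof -
  obtain B S W where \<tau>: "\<tau> = (B, S, W)" by (metis surj_pair)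
  obtain L where L: "std_path L" "path_tab L = W" "length L = n"
    using std_triple_path st unfolding \<tau> by metis
  have "Suc (n - Suc k) < length L" using L k by auto
  \<comment> \<open>List position 0 holds the box of the entry \<open>n\<close>, so with this length
    of \<open>xs\<close> the entry \<open>k + 1\<close> sits in \<open>c\<close> and
    \<open>k\<close> in \<open>d\<close>.\<close>
  then obtain xs c d ys where X: "L = xs @ c # d # ys" "length xs = n - Suc k" by (rule split_two_at)
  have ys: "length ys = k - 1" using X L k by auto
  have nk: "n - k = Suc (length xs)" using X k by auto
  let ?L' = "xs @ d # c # ys"
  let ?\<tau>' = "(B, S, path_tab ?L')"
  let ?H = "h_op P m n lam' lam (n - k)" and ?J = "JM P m n lam' lam k"
  have std: "std_path (xs @ c # d # ys)" and n: "n = length (xs @ c # d # ys)" using L X by auto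
  have \<tau>L: "\<tau> = (B, S, path_tab (xs @ c # d # ys))" using \<tau> L X by simp
  have H: "?H (delta \<tau>) = (\<lambda>\<sigma>. aco c d * delta \<tau> \<sigma> + oco c d * delta ?\<tau>' \<sigma>)"
    using lin_delta[OF finite_Tset, of \<tau> m n lam' lam] st h_basis_path[OF std n, of B S]
    unfolding h_op_def nk \<tau>L by (simp add: Tset_def)
  have lin: "linear_op ?H" "linear_op ?J" by (simp_all add: h_op_def linear_op_lin linear_op_JM)
  have dist: "distinct (xs @ c # d # ys)" using std_path_distinct[OF std] .
  have wd: "Wt P n \<tau> (k - 1) = q powi HD d"
    using Wt_path[of "xs @ [c]" d ys n B S] dist n ys \<tau>L by simp
  have wc: "Wt P n \<tau> k = q powi HD c"
    using Wt_path[of xs c "d # ys" n B S] dist n ys k \<tau>L by simp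
  have J: "?J (delta \<tau>) = (\<lambda>\<sigma>. q powi HD d * delta \<tau> \<sigma>)" using IH[OF st] wd by simp
  have JM: "JM P m n lam' lam (Suc k) (delta \<tau>) = (\<lambda>\<sigma>. ?H (?J (?H (delta \<tau>))) \<sigma> / - (\<alpha> * \<beta>))"
    using k by simp
  show ?thesis
  proof (cases "fst c = fst d \<or> snd c = snd d")
    case True
    have "aco c d * aco c d * q powi HD d = - (\<alpha> * \<beta>) * q powi HD c"
    proof (cases "fst c = fst d")
      case True
      then have h: "HD d - HD c = 1" using std_path_consecutive[OF std] by simp
      then have "q powi HD d = q * q powi HD c"
        using power_int_add[of q "HD c" 1] by (simp add: algebra_simps)
      then show ?thesis using aco_row[OF h] beta_eq by simp
    next
      case False
      then have h: "HD d - HD c = - 1" using std_path_consecutive[OF std] True by simp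
      then have "q powi HD c = q * q powi HD d"
        using power_int_add[of q "HD d" 1] by (simp add: algebra_simps)
      then show ?thesis using aco_col[OF h] beta_eq by simp
    qed
    moreover have "?H (delta \<tau>) = (\<lambda>\<sigma>. aco c d * delta \<tau> \<sigma>)" using H True by (simp add: oco_def)
    ultimately show ?thesis unfolding JM wc by (intro conj_scalar[OF lin _ J])
  next
    case False
    have std': "std_path ?L'" using std_path_swap_append[OF std] False by simp
    have st': "std_triple m n lam' lam ?\<tau>'"
      by (rule std_triple_change_path[OF st[unfolded \<tau>L] std std']) auto
    have n': "n = length ?L'" using n by simp
    have H': "?H (delta ?\<tau>') = (\<lambda>\<sigma>. aco d c * delta ?\<tau>' \<sigma> + oco d c * delta \<tau> \<sigma>)"
      using lin_delta[OF finite_Tset, of ?\<tau>' m n lam' lam] st' h_basis_path[OF std' n', of B S]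
      unfolding h_op_def nk \<tau>L by (simp add: Tset_def)
    have "Wt P n ?\<tau>' (k - 1) = q powi HD c"
      using Wt_path[of "xs @ [d]" c ys n B S] dist n ys by auto
    then have J': "?J (delta ?\<tau>') = (\<lambda>\<sigma>. q powi HD c * delta ?\<tau>' \<sigma>)" using IH[OF st'] by simp
    have ne: "q powi HD d \<noteq> 0" "q powi HD c \<noteq> 0" "q powi HD d \<noteq> q powi HD c"
      using std_path_consecutive(1)[OF std] by auto
    have x: "q powi (HD d - HD c) = q powi HD d / q powi HD c" "q powi (HD c - HD d) = q powi HD c / q powi HD d"
      by (simp_all add: power_int_diff)
    have "oco c d * oco d c = - \<alpha> * \<beta> * Ffun P (q powi HD d / q powi HD c)"
      using eta_mult(1)[of "q powi HD d / q powi HD c"] ne False by (auto simp: oco_def x)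
    then show ?thesis unfolding JM wc
      using H H' by (intro conj_swap[OF lin _ _ J J' ne]) (simp_all add: aco_def x)
  qed
qed

section \<open>The generators g and the indices above n + 1\<close>

lemma Wt_primed:
  assumes "1 \<le> i"
  shows "Wt P n (B, S, W) (n + i - 1) = (if i \<in> vals B then q powi HD (pos B i) else - tht P * q powi (- HD (pos S i)))"
proof -
  have "(n + i - 1 < n) = False" "n + i - 1 + 1 - n = i" using assms by auto
  then show ?thesis by (simp only: Wt_def prod.case Let_def if_False)
qed

lemma g_basis_eq:
  assumes "vals B \<inter> vals S = {}"
  shows "g_basis P n j (B, S, W) =
   (if same_row j B \<or> same_row j S then (\<lambda>\<sigma>. \<alpha> * delta (B, S, W) \<sigma>)
    else if same_col j B \<or> same_col j S then (\<lambda>\<sigma>. \<beta> * delta (B, S, W) \<sigma>)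
    else (\<lambda>\<sigma>. (\<alpha> + \<beta>) / (1 - Wt P n (B, S, W) (n + j - 1) / Wt P n (B, S, W) (n + j)) * delta (B, S, W) \<sigma>
        + zeta P (Wt P n (B, S, W) (n + j - 1) / Wt P n (B, S, W) (n + j))
          * delta (swapv j (j + 1) B, swapv j (j + 1) S, W) \<sigma>))"
proof (cases "j \<in> vals B \<and> j + 1 \<in> vals B")
  case True
  then have "j \<notin> vals S" using assms by auto
  then show ?thesis using True by (simp add: g_basis_def Let_def same_row_def same_col_def)
next
  case False
  then have "same_row j B = False" "same_col j B = False" "(j \<in> vals B \<and> j + 1 \<in> vals B) = False"
    by (auto simp: same_row_def same_col_def)
  moreover have "same_row j S \<longleftrightarrow> (j \<in> vals S \<and> j + 1 \<in> vals S) \<and> fst (pos S j) = fst (pos S (j + 1))"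
    "same_col j S \<longleftrightarrow> (j \<in> vals S \<and> j + 1 \<in> vals S) \<and> snd (pos S j) = snd (pos S (j + 1))"
    by (auto simp: same_row_def same_col_def)
  ultimately show ?thesis by (simp only: g_basis_def Let_def prod.case if_False simp_thms)
qed

text \<open>The filling \<open>S\<close> decreases where \<open>B\<close> increases, but its weights
  use the opposite exponent, so alignment has the same effect in both. Labels in different fillings
  have different weights because - \<theta> is not a power of q.\<close>

lemma weights_primed:
  assumes st: "std_triple m n lam' lam (B, S, W)" and y: "young lam'" "young lam"
    and j: "1 \<le> j" "j + 1 \<le> m"
  defines "\<mu> \<equiv> Wt P n (B, S, W) (n + j - 1)" and "\<nu> \<equiv> Wt P n (B, S, W) (n + j)"
  shows "\<mu> \<noteq> 0" "\<nu> \<noteq> 0" "\<mu> \<noteq> \<nu>"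
    "same_row j B \<or> same_row j S \<Longrightarrow> \<mu> = q * \<nu>" "same_col j B \<or> same_col j S \<Longrightarrow> \<nu> = q * \<mu>"
proof -
  note yW = std_tripleD(1)[OF st] and B = std_tripleD(6-8)[OF st] and sS = std_tripleD(9)[OF st]
    and S = std_tripleD(10,11)[OF st] and v = std_tripleD(12,13)[OF st]
  have "j \<in> vals B \<union> vals S" "j + 1 \<in> vals B \<union> vals S" unfolding v(2) using j by auto
  then have jv: "j \<in> vals B \<or> j \<in> vals S" "j + 1 \<in> vals B \<or> j + 1 \<in> vals S" by blast+
  have \<mu>: "\<mu> = (if j \<in> vals B then q powi HD (pos B j) else - tht P * q powi (- HD (pos S j)))"
    unfolding \<mu>_def using Wt_primed[OF j(1)] .
  have \<nu>: "\<nu> = (if j + 1 \<in> vals B then q powi HD (pos B (j + 1)) else - tht P * q powi (- HD (pos S (j + 1))))"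
    unfolding \<nu>_def using Wt_primed[of "j + 1"] by simp
  show "\<mu> \<noteq> 0" "\<nu> \<noteq> 0" unfolding \<mu> \<nu> by auto
  have cB: "convex_boxes (shape B)" using convex_boxes_young y B by simp
  have cS: "convex_boxes (shape S)" using convex_boxes_skew[OF yW y(2)] sS by simp
  have bS: "S x \<le> m" if "x \<in> shape S" for x
  proof -
    have "S x \<in> vals B \<union> vals S" using that by (simp add: vals_def)
    then show ?thesis unfolding v(2) by simp
  qed
  have fB: "same_row j B \<Longrightarrow> HD (pos B (j + 1)) = HD (pos B j) - 1"
      "same_col j B \<Longrightarrow> HD (pos B (j + 1)) = HD (pos B j) + 1" "HD (pos B j) \<noteq> HD (pos B (j + 1))"
    if "j \<in> vals B" "j + 1 \<in> vals B"
    using consecutive_incr[OF cB B(3), of "pos B j" "pos B (j + 1)"] pos_vals[OF B(2)] that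
    by (auto simp: same_row_def same_col_def)
  have fS: "same_row j S \<Longrightarrow> HD (pos S (j + 1)) = HD (pos S j) + 1"
      "same_col j S \<Longrightarrow> HD (pos S (j + 1)) = HD (pos S j) - 1" "HD (pos S j) \<noteq> HD (pos S (j + 1))"
    if "j \<in> vals S" "j + 1 \<in> vals S"
    using consecutive_decr[OF cS S(2), of "pos S j" "pos S (j + 1)" m] pos_vals[OF S(1)] that bS
    by (auto simp: same_row_def same_col_def)
  have gen: "q powi a \<noteq> - tht P * q powi b" for a b
  proof
    assume "q powi a = - tht P * q powi b"
    then have "tht P = - (q powi (a - b))" by (simp add: power_int_diff field_simps)
    then show False using generic unfolding generic_params_def by blast
  qed
  show "\<mu> \<noteq> \<nu>"
    unfolding \<mu> \<nu> using jv fB(3) fS(3) gen gen[symmetric] by auto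
  have qs: "q powi (a + 1) = q * q powi a" "q powi a = q * q powi (a - 1)" for a :: int
    using power_int_add[of q a 1] power_int_add[of q "a - 1" 1] by simp_all
  show "\<mu> = q * \<nu>" if "same_row j B \<or> same_row j S"
    using that
  proof
    assume r: "same_row j B"
    then have m: "j \<in> vals B" "j + 1 \<in> vals B" by (auto simp: same_row_def)
    show ?thesis unfolding \<mu> \<nu> using m fB(1)[OF m r] qs(2)[of "HD (pos B j)"] by simp
  next
    assume r: "same_row j S"
    then have m: "j \<in> vals S" "j + 1 \<in> vals S" by (auto simp: same_row_def)
    then have "j \<notin> vals B" "j + 1 \<notin> vals B" using v(1) by blast+
    then show ?thesis unfolding \<mu> \<nu> using fS(1)[OF m r] qs(2)[of "- HD (pos S j)"] by simp
  qed
  show "\<nu> = q * \<mu>" if "same_col j B \<or> same_col j S"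
    using that
  proof
    assume r: "same_col j B"
    then have m: "j \<in> vals B" "j + 1 \<in> vals B" by (auto simp: same_col_def)
    show ?thesis unfolding \<mu> \<nu> using m fB(2)[OF m r] qs(1)[of "HD (pos B j)"] by simp
  next
    assume r: "same_col j S"
    then have m: "j \<in> vals S" "j + 1 \<in> vals S" by (auto simp: same_col_def)
    then have "j \<notin> vals B" "j + 1 \<notin> vals B" using v(1) by blast+
    then show ?thesis unfolding \<mu> \<nu> using fS(2)[OF m r] qs(1)[of "- HD (pos S j)"] by simp
  qed
qed

text \<open>Same scheme as \<open>JM_h_step\<close> with \<zeta> in place of \<eta>. The exchange
  case includes labels lying in different fillings, where the exchange moves them between
  \<open>B\<close> and \<open>S\<close>.\<close>

lemma JM_g_step:
  assumes j: "1 \<le> j" "j + 1 \<le> m" and n: "1 \<le> n" and y: "young lam'" "young lam"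
    and IH: "\<And>\<tau>. std_triple m n lam' lam \<tau> \<Longrightarrow>
      JM P m n lam' lam (n + j) (delta \<tau>) = (\<lambda>\<sigma>. Wt P n \<tau> (n + j - 1) * delta \<tau> \<sigma>)"
    and st: "std_triple m n lam' lam \<tau>"
  shows "JM P m n lam' lam (Suc (n + j)) (delta \<tau>) = (\<lambda>\<sigma>. Wt P n \<tau> (n + j) * delta \<tau> \<sigma>)"
proof -
  obtain B S W where \<tau>: "\<tau> = (B, S, W)" by (metis surj_pair)
  note st = st[unfolded \<tau>]
  let ?H = "g_op P m n lam' lam j" and ?J = "JM P m n lam' lam (n + j)"
  let ?B' = "swapv j (j + 1) B" and ?S' = "swapv j (j + 1) S"
  define \<mu> \<nu> where "\<mu> = Wt P n (B, S, W) (n + j - 1)" and "\<nu> = Wt P n (B, S, W) (n + j)"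
  note w = weights_primed[OF st y j, folded \<mu>_def \<nu>_def]
  have dis: "vals B \<inter> vals S = {}" using st by (auto simp: std_triple_def)
  have lin: "linear_op ?H" "linear_op ?J" by (simp_all add: g_op_def linear_op_lin linear_op_JM)
  have J: "?J (delta (B, S, W)) = (\<lambda>\<sigma>. \<mu> * delta (B, S, W) \<sigma>)" using IH[OF st] by (simp add: \<mu>_def)
  have JM: "JM P m n lam' lam (Suc (n + j)) (delta (B, S, W)) = (\<lambda>\<sigma>. ?H (?J (?H (delta (B, S, W)))) \<sigma> / - (\<alpha> * \<beta>))"
    using j n by simp
  have H: "?H (delta (B, S, W)) = g_basis P n j (B, S, W)"
    using lin_delta[OF finite_Tset] st unfolding g_op_def by (simp add: Tset_def)
  show ?thesis
  proof (cases "same_row j B \<or> same_row j S \<or> same_col j B \<or> same_col j S")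
    case True
    define a where "a = (if same_row j B \<or> same_row j S then \<alpha> else \<beta>)"
    have "a * a * \<mu> = - (\<alpha> * \<beta>) * \<nu>" using w(4,5) True by (auto simp: a_def beta_eq)
    moreover have "?H (delta (B, S, W)) = (\<lambda>\<sigma>. a * delta (B, S, W) \<sigma>)"
      unfolding H g_basis_eq[OF dis] using True by (auto simp: a_def)
    ultimately show ?thesis unfolding \<tau> JM \<nu>_def[symmetric] by (intro conj_scalar[OF lin _ J])
  next
    case False
    have st': "std_triple m n lam' lam (?B', ?S', W)" using std_triple_swapv[OF st j] False by blast
    have dis': "vals ?B' \<inter> vals ?S' = {}" using st' by (auto simp: std_triple_def)
    have w1: "Wt P n (?B', ?S', W) (n + j - 1) = \<nu>"
      unfolding Wt_primed[OF j(1)] in_vals_swapv[OF j(1)] pos_swapv \<nu>_def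
      using Wt_primed[of "j + 1" n B S W] by simp
    have w2: "Wt P n (?B', ?S', W) (n + j) = \<mu>"
      using Wt_primed[of "j + 1" n ?B' ?S' W] Wt_primed[OF j(1), of n B S W]
      unfolding in_vals_swapv[OF j(1)] pos_swapv \<mu>_def by simp
    have J': "?J (delta (?B', ?S', W)) = (\<lambda>\<sigma>. \<nu> * delta (?B', ?S', W) \<sigma>)" using IH[OF st'] w1 by simp
    have H1: "?H (delta (B, S, W)) = (\<lambda>\<sigma>. (\<alpha> + \<beta>) / (1 - \<mu> / \<nu>) * delta (B, S, W) \<sigma>
        + zeta P (\<mu> / \<nu>) * delta (?B', ?S', W) \<sigma>)"
      unfolding H g_basis_eq[OF dis] using False by (simp add: \<mu>_def \<nu>_def)
    have "?H (delta (?B', ?S', W)) = g_basis P n j (?B', ?S', W)"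
      using lin_delta[OF finite_Tset] st' unfolding g_op_def by (simp add: Tset_def)
    also have "\<dots> = (\<lambda>\<sigma>. (\<alpha> + \<beta>) / (1 - \<nu> / \<mu>) * delta (?B', ?S', W) \<sigma>
        + zeta P (\<nu> / \<mu>) * delta (B, S, W) \<sigma>)"
      unfolding g_basis_eq[OF dis'] same_row_swapv[OF j(1)] same_col_swapv[OF j(1)] w1 w2 swapv_swapv
      using False by simp
    finally have H2: "?H (delta (?B', ?S', W)) = \<dots>" .
    have "zeta P (\<mu> / \<nu>) * zeta P (\<nu> / \<mu>) = - \<alpha> * \<beta> * Ffun P (\<mu> / \<nu>)"
      using eta_mult(2)[of "\<mu> / \<nu>"] w(1-3) by simp
    then show ?thesis unfolding \<tau> JM \<nu>_def[symmetric]
      by (intro conj_swap[OF lin H1 H2 J J' w(1-3)])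
  qed
qed

section \<open>The element with index n + 1\<close>

lemma hinv_op_path:
  assumes "linear_form \<phi>" "std_path L" "std_triple m n lam' lam (B, Sof (set L), path_tab L)" "Suc i < n"
  shows "\<phi> (hinv_op P m n lam' lam (Suc i) (delta (B, Sof (set L), path_tab L))) =
    hinv_fun i (\<lambda>L'. \<phi> (delta (B, Sof (set L'), path_tab L'))) L"
proof -
  have "length L = n"
    using bij_betw_same_card[OF std_tripleD(4)[OF assms(3)]] distinct_card[OF std_path_distinct[OF assms(2)]]
    by (simp add: shape_path_tab)
  then have len: "Suc i < length L" using assms(4) by simp
  obtain xs c d ys where X: "L = xs @ c # d # ys" "length xs = i" using len by (rule split_two_at)
  \<comment> \<open>The filling \<open>S\<close> enters as a function of the diagram, since
    \<open>E\<close> changes both together. An exchange inside the path preserves its set of boxes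
    and hence this filling.\<close>
  let ?S = "Sof (set L)"
  have sL: "set (xs @ d # c # ys) = set L" using X by auto
  have "h_op P m n lam' lam (Suc i) (delta (B, ?S, path_tab L)) =
    (\<lambda>\<sigma>. aco c d * delta (B, ?S, path_tab L) \<sigma> + oco c d * delta (B, ?S, path_tab (xs @ d # c # ys)) \<sigma>)"
    using lin_delta[OF finite_Tset, of "(B, ?S, path_tab L)" m n lam' lam] assms(2,3) \<open>length L = n\<close>
      h_basis_path[of xs c d ys n B ?S] X
    unfolding h_op_def by (simp add: Tset_def)
  then have "hinv_op P m n lam' lam (Suc i) (delta (B, ?S, path_tab L)) =
    (\<lambda>\<sigma>. tco c d * delta (B, ?S, path_tab L) \<sigma> + sco c d * delta (B, ?S, path_tab (xs @ d # c # ys)) \<sigma>)"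
    unfolding hinv_op_def tco_aco sco_oco by (simp add: fun_eq_iff divide_simps) (simp add: algebra_simps)
  then have "\<phi> (hinv_op P m n lam' lam (Suc i) (delta (B, ?S, path_tab L))) =
     tco c d * \<phi> (delta (B, ?S, path_tab L)) + sco c d * \<phi> (delta (B, ?S, path_tab (xs @ d # c # ys)))"
    using linear_formD[OF assms(1)] by simp
  then show ?thesis
    using hinv_fun_append[of xs "\<lambda>L'. \<phi> (delta (B, Sof (set L'), path_tab L'))" c d ys] X sL by simp
qed

text \<open>The innermost inverse generator is moved out first, so the form stays fixed and the path
  varies in the induction. In \<open>Lh_path\<close> the outermost generator is absorbed into the
  form, which therefore varies there.\<close>

lemma Rh_path:
  assumes "linear_form \<phi>" "std_path L" "k < n"
    and "\<And>L'. std_path L' \<Longrightarrow> set L' = set L \<Longrightarrow> std_triple m n lam' lam (B, Sof (set L'), path_tab L')"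
  shows "\<phi> (Rh P m n lam' lam k (delta (B, Sof (set L), path_tab L))) =
    Rfun k (\<lambda>L'. \<phi> (delta (B, Sof (set L'), path_tab L'))) L"
  using assms
proof (induction k arbitrary: L)
  case (Suc k)
  have lf: "linear_form (\<lambda>v. \<phi> (Rh P m n lam' lam k v))"
    using linear_form_comp[OF Suc.prems(1) linear_op_Rh] .
  have "\<phi> (Rh P m n lam' lam (Suc k) (delta (B, Sof (set L), path_tab L))) =
    hinv_fun k (\<lambda>L'. \<phi> (Rh P m n lam' lam k (delta (B, Sof (set L'), path_tab L')))) L"
    using hinv_op_path[OF lf Suc.prems(2)] Suc.prems by simp
  also have "\<dots> = hinv_fun k (Rfun k (\<lambda>L'. \<phi> (delta (B, Sof (set L'), path_tab L')))) L"
    by (rule hinv_fun_cong[OF Suc.prems(2)], rule Suc.IH) (use Suc.prems in auto)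
  finally show ?case by simp
qed simp

lemma Lh_path:
  assumes "linear_form \<phi>" "std_path L" "k < n"
    and "\<And>L'. std_path L' \<Longrightarrow> set L' = set L \<Longrightarrow> std_triple m n lam' lam (B, Sof (set L'), path_tab L')"
  shows "\<phi> (Lh P m n lam' lam k (delta (B, Sof (set L), path_tab L))) =
    Lfun k (\<lambda>L'. \<phi> (delta (B, Sof (set L'), path_tab L'))) L"
  using assms
proof (induction k arbitrary: \<phi>)
  case (Suc k)
  have lf: "linear_form (\<lambda>v. \<phi> (hinv_op P m n lam' lam (Suc k) v))"
    using linear_form_comp[OF Suc.prems(1) linear_op_hinv] .
  have "\<phi> (Lh P m n lam' lam (Suc k) (delta (B, Sof (set L), path_tab L))) =
    Lfun k (\<lambda>L'. \<phi> (hinv_op P m n lam' lam (Suc k) (delta (B, Sof (set L'), path_tab L')))) L"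
    using Suc.IH[OF lf Suc.prems(2)] Suc.prems by simp
  also have "\<dots> = Lfun k (hinv_fun k (\<lambda>L'. \<phi> (delta (B, Sof (set L'), path_tab L')))) L"
    by (rule Lfun_cong[OF Suc.prems(2)], rule hinv_op_path) (use Suc.prems in auto)
  finally show ?case by simp
qed simp

lemma J_np1_eq:
  "J_np1 P m n lam' lam v \<sigma> = v \<sigma> - (\<alpha> + \<beta>) * kap P *
    (\<Sum>i<n. (- (\<alpha> * \<beta>)) ^ i * Lh P m n lam' lam i (E_op P m n lam' lam (Rh P m n lam' lam i v)) \<sigma>)"
  unfolding J_np1_def One_nat_def sum.atLeast1_atMost_eq by simp

text \<open>The generators h do not alter \<open>S\<close>, so the label 1 stays outside
  \<open>S\<close> and \<open>E\<close> annihilates every triple that the right factor can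
  produce.\<close>

lemma J_np1_B:
  assumes st: "std_triple m n lam' lam (B, S, W)" and B: "1 \<in> vals B"
  shows "J_np1 P m n lam' lam (delta (B, S, W)) = delta (B, S, W)"
proof
  fix \<sigma>
  obtain L where L: "std_path L" "path_tab L = W" "length L = n" using std_triple_path[OF st] .
  have nS: "1 \<notin> vals S" using std_tripleD(12)[OF st] B by blast
  have adm: "std_triple m n lam' lam (B, S, path_tab L')" if "std_path L'" "set L' = set L" for L'
    using std_triple_change_path[OF _ L(1) that] st L by simp
  have "Lh P m n lam' lam i (E_op P m n lam' lam (Rh P m n lam' lam i (delta (B, S, W)))) \<sigma> = 0" if "i < n" for i
  proof -
    have linE: "linear_op (E_op P m n lam' lam)" by (simp add: E_op_def linear_op_lin)
    have lf: "linear_form (\<lambda>v. Lh P m n lam' lam i (E_op P m n lam' lam v) \<sigma>)"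
      using linear_form_comp[OF linear_form_eval linear_op_comp[OF linear_op_Lh linE]] .
    have "Lh P m n lam' lam i (E_op P m n lam' lam (Rh P m n lam' lam i (delta (B, S, W)))) \<sigma> =
      Rfun i (\<lambda>L'. Lh P m n lam' lam i (E_op P m n lam' lam (delta (B, S, path_tab L'))) \<sigma>) L"
      using Rh_path[OF lf L(1) that, where Sof = "\<lambda>_. S"] adm L(2) by simp
    \<comment> \<open>The zero function is written as a multiple so that \<open>Rfun_scale\<close>
      gives 0.\<close>
    also have "\<dots> = Rfun i (\<lambda>L'. 0 * 0) L"
    proof (rule Rfun_cong[OF L(1)])
      fix L' assume "std_path L'" "set L' = set L"
      then have "E_op P m n lam' lam (delta (B, S, path_tab L')) = (\<lambda>\<sigma>. 0)"
        using lin_delta[OF finite_Tset] adm nS unfolding E_op_def by (simp add: Tset_def E_basis_def)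
      then show "Lh P m n lam' lam i (E_op P m n lam' lam (delta (B, S, path_tab L'))) \<sigma> = 0 * 0"
        using linear_op_scale[OF linear_op_Lh, of P m n lam' lam i 0 "\<lambda>_. 0"] by simp
    qed
    also have "\<dots> = 0" unfolding Rfun_scale by simp
    finally show ?thesis .
  qed
  then show "J_np1 P m n lam' lam (delta (B, S, W)) \<sigma> = delta (B, S, W) \<sigma>"
    unfolding J_np1_eq by simp
qed

text \<open>Expanding \<open>E\<close> over the addable boxes of \<open>D\<close> turns the sum into
  relative traces of \<open>move_hd b0 b\<close>. Only \<open>b = b0\<close> survives, and its
  coefficient times \<open>ecoef b0 D\<close> is the common prefactor \<open>c0\<close>. What
  remains is the identity \<open>1 - (1 + tht P * q powi (- HD b0)) = - tht P * q powi (- HD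
  b0)\<close>.\<close>

lemma J_np1_S:
  assumes st: "std_triple m n lam' lam (B, S, W)" and S1: "1 \<in> vals S" and y: "young lam"
  shows "J_np1 P m n lam' lam (delta (B, S, W)) = (\<lambda>\<sigma>. - tht P * q powi (- HD (pos S 1)) * delta (B, S, W) \<sigma>)"
proof
  fix \<sigma>
  note d = std_tripleD[OF st]
  define b0 where "b0 = pos S 1"
  define D where "D = shape W - {b0}"
  define S0 where "S0 = S(b0 := 0)"
  \<comment> \<open>For a diagram \<open>X\<close> obtained from \<open>D\<close> by adding one box,
    the label 1 goes into that box; all other labels stay as in \<open>S\<close>.\<close>
  define Sof where "Sof X = S0((THE b. b \<in> X - D) := 1)" for X
  obtain L0 where L0: "std_path L0" "path_tab L0 = W" "length L0 = n" using std_triple_path[OF st] .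
  have b0: "S b0 = 1" "b0 \<in> shape S" unfolding b0_def using pos_vals[OF d(10) S1] by auto
  then have b0W: "b0 \<in> shape W" "b0 \<notin> lam" using d(9) by auto
  \<comment> \<open>The label 1 is the smallest and \<open>S\<close> decreases, so no box of
    \<open>S\<close> lies to the right of it or below it.\<close>
  have b0c: "b0 \<in> corners (shape W)"
  proof -
    obtain i j where ij: "b0 = (i, j)" by force
    have ge: "1 \<le> i" "1 \<le> j" using young_ge_1[OF d(1)] b0W ij by auto
    have "(i', j') \<notin> shape W" if a: "(i = i' \<and> j < j') \<or> (j = j' \<and> i < i')" for i' j'
    proof
      assume "(i', j') \<in> shape W"
      moreover have "(i', j') \<notin> lam" using young_downward[OF y, of i' j' i j] b0W ij ge a by auto
      ultimately have s: "(i', j') \<in> shape S" using d(9) by auto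
      have "S (i', j') < 1" using rc_decrD[OF d(11) _ s a] b0 ij by simp
      then show False using s by (simp add: shape_def)
    qed
    then show ?thesis using corners_iff[OF d(1)] b0W ij by auto
  qed
  have yD: "young D" unfolding D_def using young_remove_corner[OF b0c] .
  have b0D: "b0 \<in> addable D" unfolding D_def using addable_remove_corner[OF d(1) b0c] .
  have W0: "shape W = insert b0 D" unfolding D_def using b0W by auto
  have lamD: "lam \<subseteq> D" unfolding D_def using d(2) b0W by auto
  have S0nz: "S0 x \<noteq> 1" for x
  proof
    assume "S0 x = 1"
    then have "x \<noteq> b0" "S x = 1" by (auto simp: S0_def split: if_splits)
    then show False using pos_eq[OF d(10), of x 1] by (simp add: b0_def)
  qed
  have sS0: "shape S0 = D - lam" unfolding S0_def D_def using d(9) by (auto simp: shape_def)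
  have SofE: "Sof (insert b D) = S0(b := 1)" if "b \<in> addable D" for b
  proof -
    have "(THE x. x \<in> insert b D - D) = b" using addable_notin[OF that] by auto
    then show ?thesis by (simp add: Sof_def)
  qed
  have S0b0: "S0(b0 := 1) = S" unfolding S0_def using b0 by auto
  have valsS: "vals S = insert 1 (vals S0)"
  proof -
    have "shape S = insert b0 (D - lam)" using d(9) W0 b0W by auto
    moreover have "S ` (D - lam) = S0 ` (D - lam)"
      by (rule image_cong) (auto simp: S0_def D_def)
    ultimately show ?thesis unfolding vals_def sS0 using b0 by simp
  qed
  \<comment> \<open>An added box is never left of or above a box of \<open>D\<close>, so placing the
    smallest label there keeps the filling antistandard.\<close>
  have adm: "std_triple m n lam' lam (B, S0(b := 1), path_tab L)"
    if b: "b \<in> addable D" and L: "std_path L" "set L = insert b D" for b L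
  proof -
    have bD: "b \<notin> D" using addable_notin[OF b] .
    have finD: "finite D" using young_finite[OF yD] .
    have sS: "shape (S0(b := 1)) = insert b D - lam"
      using sS0 bD lamD by (auto simp: shape_def)
    have "card (insert b D) = card (insert b0 D)"
      using bD addable_notin[OF b0D] finD by simp
    moreover have "card (insert b0 D) = n" using bij_betw_same_card[OF d(4)] W0 by simp
    ultimately have len: "length L = n" using distinct_card[OF std_path_distinct[OF L(1)]] L(2) by simp
    have c: "card (insert b D - lam) = m - card lam'"
    proof -
      have "insert b D - lam = insert b (D - lam)" "insert b0 D - lam = insert b0 (D - lam)"
        using bD lamD b0W by auto
      then show ?thesis using d(3) W0 bD addable_notin[OF b0D] finD by simp
    qed
    have inj: "inj_on (S0(b := 1)) (insert b D - lam)"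
    proof (rule inj_onI)
      fix x z assume a: "x \<in> insert b D - lam" "z \<in> insert b D - lam" "(S0(b := 1)) x = (S0(b := 1)) z"
      show "x = z"
      proof (cases "x = b \<or> z = b")
        case True
        then show ?thesis using a(3) S0nz[of x] S0nz[of z] by (auto split: if_splits)
      next
        case False
        then have "x \<in> shape S0" "z \<in> shape S0" "S0 x = S0 z" using a sS0 by auto
        then have "x \<in> shape S" "z \<in> shape S" "S x = S z" by (auto simp: S0_def shape_def split: if_splits)
        then show ?thesis using inj_onD[OF d(10)] by blast
      qed
    qed
    have decr: "rc_decr (S0(b := 1)) (insert b D - lam)"
    proof (rule rc_decrI)
      fix i j i' j'
      assume a: "(i, j) \<in> insert b D - lam" "(i', j') \<in> insert b D - lam" "(i = i' \<and> j < j') \<or> (j = j' \<and> i < i')"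
      have nb: "(i, j) \<noteq> b"
      proof
        assume e: "(i, j) = b"
        have ge: "1 \<le> i" "1 \<le> j" using b addable_iff[OF yD, of i j] e by auto
        have "(i', j') \<in> D" using a e by auto
        then show False using young_downward[OF yD, of i' j' i j] a(3) e bD ge by auto
      qed
      then have "(i, j) \<in> shape S0" using a sS0 by auto
      then have ij: "(i, j) \<in> shape S" "S0 (i, j) = S (i, j)" by (auto simp: S0_def shape_def split: if_splits)
      show "(S0(b := 1)) (i', j') < (S0(b := 1)) (i, j)"
      proof (cases "(i', j') = b")
        case True
        then show ?thesis using nb S0nz[of "(i, j)"] \<open>(i, j) \<in> shape S0\<close> by (auto simp: shape_def)
      next
        case False
        then have "(i', j') \<in> shape S0" using a sS0 by auto
        then have "(i', j') \<in> shape S" "S0 (i', j') = S (i', j')" by (auto simp: S0_def shape_def split: if_splits)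
        then show ?thesis using rc_decrD[OF d(11) ij(1) _ a(3)] nb False ij(2) by simp
      qed
    qed
    have v: "vals (S0(b := 1)) = vals S"
    proof -
      have e: "insert b D - lam = insert b (D - lam)" using bD lamD by auto
      have "(S0(b := 1)) ` (D - lam) = S0 ` (D - lam)" using bD by (intro image_cong) auto
      then show ?thesis unfolding valsS unfolding vals_def sS sS0 e image_insert by (simp only: fun_upd_same)
    qed
    have "bij_betw (path_tab L) (set L) {1..n}" using bij_betw_path_tab[OF std_path_distinct[OF L(1)]] len by simp
    then show ?thesis
      unfolding std_triple_def prod.case v shape_path_tab sS L(2)
      using std_path_young[OF L(1)] rc_incr_path_tab[OF L(1)] lamD c inj decr d(6-8,12,13) L(2) by auto
  qed
  let ?tr = "\<lambda>L. (B, Sof (set L), path_tab L)"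
  let ?T = "std_triple m n lam' lam"
  have admT: "?T (?tr L)" if "b \<in> addable D" "std_path L" "set L = insert b D" for b L
    using adm[OF that] SofE[OF that(1)] that(3) by simp
  have sL0: "set L0 = insert b0 D" using L0 W0 shape_path_tab by metis
  have trL0: "?tr L0 = (B, S, W)" using SofE[OF b0D] sL0 S0b0 L0 by simp
  define c0 where "c0 = (1 + tht P * q powi (- HD b0)) / (kap P * (\<alpha> + \<beta>))"
  define dc where "dc b = c0 * (\<Prod>x\<in>corners D. 1 - q powi (HD x - HD b)) / (\<Prod>a\<in>addable D - {b}. 1 - q powi (HD a - HD b))" for b
  have dc: "dc b0 * ecoef b0 D = c0"
    unfolding dc_def ecoef_def using prod_corners_nz[OF yD b0D] prod_addable_nz[OF yD b0D] by simp
  \<comment> \<open>\<open>E\<close> is nonzero only if the entry \<open>n\<close> occupies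
    \<open>b0\<close>, that is, if \<open>b0\<close> is the head of the path. Moving that box
    replaces the head, and \<open>Sof\<close> moves the label 1 along with it.\<close>
  have E: "E_op P m n lam' lam (delta (?tr L)) =
      (\<lambda>\<sigma>. \<Sum>b\<in>addable D. (if hd L = b0 then dc b else 0) * delta (?tr (b # tl L)) \<sigma>)"
    if L: "std_path L" "set L = insert b0 D" for L
  proof -
    obtain c U where cU: "L = c # U" using L(2) by (cases L) auto
    have len: "length L = n"
      using distinct_card[OF std_path_distinct[OF L(1)]] distinct_card[OF std_path_distinct[OF L0(1)]] L(2) sL0 L0(3) by simp
    have trL: "?tr L = (B, S, path_tab L)" using SofE[OF b0D] L(2) S0b0 by simp
    have e1: "E_op P m n lam' lam (delta (?tr L)) = E_basis P n (B, S, path_tab L)"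
      using lin_delta[OF finite_Tset] admT[OF b0D L] unfolding E_op_def trL by (simp add: Tset_def)
    show ?thesis
    proof (cases "c = b0")
      case True
      have w: "path_tab L b0 = n" using cU True len by simp
      have b0U: "b0 \<notin> set U" using std_path_distinct[OF L(1)] cU True by simp
      have sU: "set U = D" using L(2) cU True b0U addable_notin[OF b0D] by auto
      have sh: "shape (path_tab L) - {b0} = D" using L(2) addable_notin[OF b0D] by (auto simp: shape_path_tab)
      have tr': "(B, S(b0 := 0, b := 1), (path_tab L)(b0 := 0, b := n)) = ?tr (b # tl L)" if "b \<in> addable D" for b
      proof -
        have "(path_tab L)(b0 := 0, b := n) = path_tab (b # U)"
          using cU True len b0U path_tab_eq_0_iff[of U b0] by (auto simp: fun_eq_iff)
        then show ?thesis using SofE[OF that] sU cU by (simp add: S0_def)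
      qed
      have "E_basis P n (B, S, path_tab L) = (\<lambda>\<sigma>. \<Sum>b\<in>addable D. dc b * delta (B, S(b0 := 0, b := 1), (path_tab L)(b0 := 0, b := n)) \<sigma>)"
        unfolding E_basis_def prod.case Let_def b0_def[symmetric] sh using S1 w by (simp add: dc_def c0_def)
      also have "\<dots> = (\<lambda>\<sigma>. \<Sum>b\<in>addable D. dc b * delta (?tr (b # tl L)) \<sigma>)"
        by (intro ext sum.cong refl) (simp only: tr')
      finally show ?thesis using e1 cU True by simp
    next
      case False
      have "path_tab L b0 \<noteq> n" using path_tab_le[of U b0] cU len False by auto
      then have "E_basis P n (B, S, path_tab L) = (\<lambda>\<sigma>. 0)"
        unfolding E_basis_def prod.case Let_def b0_def[symmetric] by simp
      then show ?thesis using e1 cU False by simp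
    qed
  qed
  define F where "F L = delta (?tr L) \<sigma>" for L
  \<comment> \<open>The right factor acts on paths over \<open>D\<close> with \<open>b0\<close>,
    \<open>E\<close> passes to \<open>D\<close> with \<open>b\<close>, and the left factor acts
    there; each is replaced by its transpose.\<close>
  have step: "Lh P m n lam' lam i (E_op P m n lam' lam (Rh P m n lam' lam i (delta (B, S, W)))) \<sigma> =
      (\<Sum>b\<in>addable D. dc b * Rfun i (move_hd b0 b (Lfun i F)) L0)" if i: "i < n" for i
  proof -
    have linE: "linear_op (E_op P m n lam' lam)" by (simp add: E_op_def linear_op_lin)
    have lfL: "linear_form (\<lambda>v. Lh P m n lam' lam i v \<sigma>)"
      using linear_form_comp[OF linear_form_eval linear_op_Lh] .
    have lf: "linear_form (\<lambda>v. Lh P m n lam' lam i (E_op P m n lam' lam v) \<sigma>)"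
      using linear_form_comp[OF linear_form_eval linear_op_comp[OF linear_op_Lh linE]] .
    have adm0: "?T (?tr L')" if "std_path L'" "set L' = set L0" for L'
      using admT[OF b0D that(1)] that(2) sL0 by simp
    have "Lh P m n lam' lam i (E_op P m n lam' lam (Rh P m n lam' lam i (delta (?tr L0)))) \<sigma> =
      Rfun i (\<lambda>L'. Lh P m n lam' lam i (E_op P m n lam' lam (delta (?tr L'))) \<sigma>) L0"
      using Rh_path[OF lf L0(1) i adm0] .
    also have "\<dots> = Rfun i (\<lambda>L'. \<Sum>b\<in>addable D. dc b * move_hd b0 b (Lfun i F) L') L0"
    proof (rule Rfun_cong[OF L0(1)])
      fix L' assume L': "std_path L'" "set L' = set L0"
      have sL': "set L' = insert b0 D" using L'(2) sL0 by simp
      obtain c U where cU: "L' = c # U" using sL' by (cases L') auto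
      have "Lh P m n lam' lam i (E_op P m n lam' lam (delta (?tr L'))) \<sigma> =
        (\<Sum>b\<in>addable D. (if hd L' = b0 then dc b else 0) * Lh P m n lam' lam i (delta (?tr (b # tl L'))) \<sigma>)"
        unfolding E[OF L'(1) sL'] using linear_form_sum[OF lfL finite_addable[OF yD]] .
      also have "\<dots> = (\<Sum>b\<in>addable D. dc b * move_hd b0 b (Lfun i F) L')"
      proof (rule sum.cong[OF refl])
        fix b assume b: "b \<in> addable D"
        show "(if hd L' = b0 then dc b else 0) * Lh P m n lam' lam i (delta (?tr (b # tl L'))) \<sigma> =
          dc b * move_hd b0 b (Lfun i F) L'"
        proof (cases "c = b0")
          case True
          have sU: "set U = D"
            using sL' cU True std_path_distinct[OF L'(1)] addable_notin[OF b0D] by auto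
          have std: "std_path (b # U)" using L'(1) cU sU b by simp
          have "?T (?tr L'')" if "std_path L''" "set L'' = set (b # U)" for L''
            using admT[OF b that(1)] that(2) sU by simp
          then have "Lh P m n lam' lam i (delta (?tr (b # U))) \<sigma> = Lfun i F (b # U)"
            unfolding F_def using Lh_path[OF linear_form_eval std i] by blast
          then show ?thesis using cU True by (simp add: move_hd_def)
        qed (simp add: cU move_hd_def)
      qed
      finally show "Lh P m n lam' lam i (E_op P m n lam' lam (delta (?tr L'))) \<sigma> =
        (\<Sum>b\<in>addable D. dc b * move_hd b0 b (Lfun i F) L')" .
    qed
    also have "\<dots> = (\<Sum>b\<in>addable D. dc b * Rfun i (move_hd b0 b (Lfun i F)) L0)" by (rule Rfun_sum)
    finally show ?thesis unfolding trL0 .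
  qed
  have "(\<Sum>i<n. (- (\<alpha> * \<beta>)) ^ i * Lh P m n lam' lam i (E_op P m n lam' lam (Rh P m n lam' lam i (delta (B, S, W)))) \<sigma>) =
    (\<Sum>i<n. \<Sum>b\<in>addable D. dc b * ((- (\<alpha> * \<beta>)) ^ i * Rfun i (move_hd b0 b (Lfun i F)) L0))"
    by (rule sum.cong[OF refl]) (simp add: step sum_distrib_left mult_ac)
  also have "\<dots> = (\<Sum>b\<in>addable D. \<Sum>i<n. dc b * ((- (\<alpha> * \<beta>)) ^ i * Rfun i (move_hd b0 b (Lfun i F)) L0))"
    by (rule sum.swap)
  also have "\<dots> = (\<Sum>b\<in>addable D. dc b * rel_trace (length L0) (move_hd b0 b) F L0)"
    unfolding rel_trace_def L0(3) sum_distrib_left ..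
  \<comment> \<open>The relative trace removes every term that changes the diagram, so the result is
    again a multiple of the given triple.\<close>
  also have "\<dots> = (\<Sum>b\<in>addable D. if b0 = b then dc b * (ecoef b0 D * F L0) else 0)"
    by (rule sum.cong[OF refl]) (simp add: rel_trace_move_hd[OF L0(1) sL0 yD b0D])
  also have "\<dots> = dc b0 * (ecoef b0 D * F L0)"
    using b0D finite_addable[OF yD] by simp
  also have "\<dots> = c0 * delta (B, S, W) \<sigma>"
    using dc unfolding F_def trL0 by (simp add: mult.assoc[symmetric])
  finally have "J_np1 P m n lam' lam (delta (B, S, W)) \<sigma> =
     delta (B, S, W) \<sigma> - (\<alpha> + \<beta>) * kap P * (c0 * delta (B, S, W) \<sigma>)"
    unfolding J_np1_eq by simp
  also have "(\<alpha> + \<beta>) * kap P * (c0 * delta (B, S, W) \<sigma>) = (1 + tht P * q powi (- HD b0)) * delta (B, S, W) \<sigma>"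
    unfolding c0_def using nz by simp
  finally show "J_np1 P m n lam' lam (delta (B, S, W)) \<sigma> = - tht P * q powi (- HD (pos S 1)) * delta (B, S, W) \<sigma>"
    unfolding b0_def[symmetric] by (simp add: algebra_simps)
qed

section \<open>Induction over the index\<close>

lemma Wt_0:
  assumes "std_triple m n lam' lam \<tau>" "1 \<le> n"
  shows "Wt P n \<tau> 0 = 1"
proof -
  obtain B S W where \<tau>: "\<tau> = (B, S, W)" by (metis surj_pair)
  obtain L where L: "std_path L" "path_tab L = W" "length L = n"
    using std_triple_path assms(1) unfolding \<tau> by metis
  then obtain xs b where X: "L = xs @ [b]" using assms(2) by (cases L rule: rev_cases) auto
  have "std_path [b]" using std_path_append L(1) X by blast
  then have "b = (1, 1)" by (simp add: addable_empty)
  moreover have "Wt P n \<tau> 0 = q powi HD b"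
    using Wt_path[of xs b "[]" n B S] std_path_distinct[OF L(1)] L X \<tau> by simp
  ultimately show ?thesis by (simp add: HD_def)
qed

text \<open>The induction starts at index 1, where the element is the identity and the weight with
  index 0 is 1 because the entry 1 sits in the box (1,1). The first h step can then use the same
  hypothesis as all later ones.\<close>

lemma JM_diagonal:
  assumes "1 \<le> n" "young lam'" "young lam" "1 \<le> k" "k \<le> m + n" "std_triple m n lam' lam \<tau>"
  shows "JM P m n lam' lam k (delta \<tau>) = (\<lambda>\<sigma>. Wt P n \<tau> (k - 1) * delta \<tau> \<sigma>)"
  using assms(4-6)
proof (induction k arbitrary: \<tau>)
  case (Suc k)
  consider "k = 0" | "1 \<le> k" "Suc k \<le> n" | "k = n" "k \<noteq> 0" | j where "k = n + j" "1 \<le> j" "k \<noteq> 0"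
    by (metis One_nat_def Suc_leI le_add_diff_inverse le_eq_less_or_eq linorder_not_le not_gr_zero zero_less_diff)
  then show ?case
  proof cases
    case 1
    then show ?thesis using Wt_0[OF Suc.prems(3) assms(1)] by simp
  next
    case 2
    then show ?thesis using JM_h_step[OF 2 _ Suc.prems(3)] Suc.IH Suc.prems by simp
  next
    case 3
    obtain B S W where \<tau>: "\<tau> = (B, S, W)" by (metis surj_pair)
    note st = Suc.prems(3)[unfolded \<tau>]
    have JM: "JM P m n lam' lam (Suc k) = J_np1 P m n lam' lam" using 3 by simp
    have m: "1 \<le> m" using 3 Suc.prems by simp
    have "1 \<in> vals B \<union> vals S" unfolding std_tripleD(13)[OF st] using m by simp
    have w: "Wt P n (B, S, W) (Suc k - 1) =
      (if 1 \<in> vals B then q powi HD (pos B 1) else - tht P * q powi (- HD (pos S 1)))"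
      using Wt_primed[of 1 n B S W] 3 by simp
    show ?thesis
    proof (cases "1 \<in> vals B")
      case True
      \<comment> \<open>The smallest label of \<open>B\<close> sits in the box (1,1), so its weight
        is 1, which agrees with the trivial action in \<open>J_np1_B\<close>.\<close>
      have "HD (pos B 1) = 0"
      proof -
        note dB = std_tripleD(6-8)[OF st]
        have p: "B (pos B 1) = 1" "pos B 1 \<in> shape B" using pos_vals[OF dB(2) True] by auto
        obtain i j where ij: "pos B 1 = (i, j)" by force
        have yB: "young (shape B)" using assms(2) dB by simp
        have ge: "1 \<le> i" "1 \<le> j" using young_ge_1[OF yB] p ij by auto
        have nz: "B x \<noteq> 0" if "x \<in> shape B" for x using that by (simp add: shape_def)
        have "i = 1"
        proof (rule ccontr)
          assume "i \<noteq> 1"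
          then have "(1, j) \<in> shape B" "1 < i" using young_downward[OF yB, of i j 1 j] p ij ge by auto
          then show False using rc_incrD[OF dB(3), of 1 j i j] p ij nz[of "(1, j)"] by auto
        qed
        moreover have "j = 1"
        proof (rule ccontr)
          assume "j \<noteq> 1"
          then have "(i, 1) \<in> shape B" "1 < j" using young_downward[OF yB, of i j i 1] p ij ge by auto
          then show False using rc_incrD[OF dB(3), of i 1 i j] p ij nz[of "(i, 1)"] by auto
        qed
        ultimately show ?thesis using ij by (simp add: HD_def)
      qed
      then show ?thesis unfolding \<tau> JM w J_np1_B[OF st True] using True by simp
    next
      case False
      then have "1 \<in> vals S" using \<open>1 \<in> vals B \<union> vals S\<close> by blast
      then show ?thesis unfolding \<tau> JM w using J_np1_S[OF st _ assms(3)] False by simp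
    qed
  next
    case (4 j)
    have "j + 1 \<le> m" using Suc.prems 4 by simp
    then have "JM P m n lam' lam (Suc (n + j)) (delta \<tau>) = (\<lambda>\<sigma>. Wt P n \<tau> (n + j) * delta \<tau> \<sigma>)"
      using Suc.IH Suc.prems 4 by (intro JM_g_step[OF 4(2) _ assms(1-3) _ Suc.prems(3)]) auto
    then show ?thesis using 4 by simp
  qed
qed simp

end

theorem theorem5p5p9:
  fixes P :: qwb_param and m n :: nat and lam' lam :: "box set"
    and \<tau> :: triple and j :: nat
  assumes "generic_params P" and "eta_zeta_ok P"
    and "1 \<le> m" and "1 \<le> n"
    and "young lam'" and "young lam"
    and "card lam' \<le> m" and "card lam \<le> n" and "m - card lam' = n - card lam"
    and "std_triple m n lam' lam \<tau>"
    and "2 \<le> j" and "j \<le> m + n"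
  shows "JM P m n lam' lam j (delta \<tau>) = (\<lambda>\<sigma>. Wt P n \<tau> (j - 1) * delta \<tau> \<sigma>)"
proof -
  interpret qwb P using assms(1,2) by unfold_locales
  show ?thesis using JM_diagonal[OF assms(4-6) _ assms(12,10)] assms(11) by simp
qed

end
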